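(* Let $p$ be a prime number, let $s$ be an odd positive divisor of $p-1$, and let $\mathbb{K}$ be the unique subfield of $\mathbb{Q}(\zeta_p)$ with $[\mathbb{K}:\mathbb{Q}]=s$. Let $\tilde{\mathcal{M}}_p\subseteq\mathcal{O}_{\mathbb{K}}$ be the $\mathbb{Z}$-submodule and $\sigma$ the canonical embedding defined in the context. Then the center density of the lattice $\sigma(\tilde{\mathcal{M}}_p)\subset\mathbb{R}^s$ satisfies $$\delta(\sigma(\tilde{\mathcal{M}}_p))\geq\frac{1}{2^{\frac{s+2}{2}}}.$$
   Context: Here $\zeta_p$ is a primitive $p$-th root of unity, $\mathbb{L}=\mathbb{Q}(\zeta_p)$, and $\mathcal{O}_{\mathbb{K}}$ is the ring of algebraic integers of $\mathbb{K}$. Let $u$ be an integer whose class generates $(\mathbb{Z}/p\mathbb{Z})^{\star}$, let $\sigma_u$ be the automorphism of $\mathbb{L}$ with $\sigma_u(\zeta_p)=\zeta_p^u$, let $\theta=\sigma_u|_{\mathbb{K}}$ (a generator of $\mathrm{Gal}(\mathbb{K}/\mathbb{Q})$), and let $t=\mathrm{Tr}_{\mathbb{L}/\mathbb{K}}(\zeta_p)$. The map $(a_0,\ldots,a_{s-1})\mapsto\sum_{i=0}^{s-1}a_i\theta^i(t)$ is an isomorphism of $\mathbb{Z}$-modules $\mathbb{Z}^s\to\mathcal{O}_{\mathbb{K}}$, and through it elements ${\bf x}\in\mathcal{O}_{\mathbb{K}}$ are identified with their coordinate vectors ${\bf x}=(a_0,\ldots,a_{s-1})\in\mathbb{Z}^s$.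 Let $\beta\in\mathbb{Z}$ be a primitive root modulo $p$ (of multiplicative order $p-1$ modulo $p$), and put $\alpha=\beta^{(p-1)/s}$. For $i=0,1,\ldots,s-1$ let $\mu_i=(1,\alpha^i,\alpha^{2i},\ldots,\alpha^{(s-1)i})\in\mathbb{Z}^s$, and let $\cdot$ denote the usual dot product on $\mathbb{Z}^s$. For $s$ odd, $\mathcal{M}_p=\{{\bf x}\in\mathcal{O}_{\mathbb{K}}:{\bf x}\cdot\mu_i\equiv 0\pmod p\text{ for all } i=0,1,\ldots,\frac{s-1}{2}\}$ and $\tilde{\mathcal{M}}_p=\{{\bf x}=(a_0,\ldots,a_{s-1})\in\mathcal{M}_p:\sum_{i=0}^{s-1}a_i\equiv 0\pmod 2\}$. Canonical embedding: let $\sigma_1,\ldots,\sigma_s$ be the embeddings $\mathbb{K}\to\mathbb{C}$, with $\sigma_1,\ldots,\sigma_{r_1}$ real and $\sigma_{r_1+1},\ldots,\sigma_{r_1+r_2}$ representatives of the $r_2$ complex-conjugate pairs of non-real ones ($s=r_1+2r_2$). Then $\sigma:\mathbb{K}\to\mathbb{R}^s$ is $\sigma(x)=(\sigma_1(x),\ldots,\sigma_{r_1}(x),\mathrm{Re}\,\sigma_{r_1+1}(x),\mathrm{Im}\,\sigma_{r_1+1}(x),\ldots,\mathrm{Re}\,\sigma_{r_1+r_2}(x),\mathrm{Im}\,\sigma_{r_1+r_2}(x))$. For a full-rank lattice $\Lambda\subset\mathbb{R}^n$, the packing radius is $\rho=\frac12\min\{\|v\|:v\in\Lambda\setminus\{0\}\}$,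 the volume $\mathrm{vol}(\Lambda)$ is the square root of the determinant of a Gram matrix of a $\mathbb{Z}$-basis of $\Lambda$, and the center density is $\delta(\Lambda)=\rho^n/\mathrm{vol}(\Lambda)$. *)

theory Defs
  imports
    Complex_Main
    "HOL-Algebra.Generated_Fields"
    "HOL-Algebra.Embedded_Algebras"
    "HOL-Algebra.RingHom"
    "HOL-Number_Theory.Number_Theory"
    "Jordan_Normal_Form.Determinant"
    "Jordan_Normal_Form.VS_Connect"
begin

abbreviation CC :: "complex ring" where
  "CC \<equiv> class_ring"

abbreviation as_ring :: "complex set \<Rightarrow> complex ring" where
  "as_ring F \<equiv> CC\<lparr>carrier := F\<rparr>"

definition primitive_unity_root :: "nat \<Rightarrow> complex \<Rightarrow> bool" where
  "primitive_unity_root n z \<longleftrightarrow> z ^ n = 1 \<and> (\<forall>k. 0 < k \<and> k < n \<longrightarrow> z ^ k \<noteq> 1)"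

abbreviation adjoin_Rats :: "complex \<Rightarrow> complex set" where
  "adjoin_Rats z \<equiv> generate_field CC {z}"

text \<open>Homomorphisms are only relevant on the subfield itself; extensionality makes each of them
  a single function, so that they can be counted and summed over.\<close>

definition embeddings :: "complex set \<Rightarrow> (complex \<Rightarrow> complex) set" where
  "embeddings F = Ring.ring_hom (as_ring F) CC \<inter> extensional F"

definition ring_integers :: "complex set \<Rightarrow> complex set" where
  "ring_integers F = {x \<in> F. algebraic_int x}"

text \<open>The relative trace of \<open>E/F\<close>, as the sum of the conjugates over \<open>F\<close>. For \<open>E/F\<close> Galois
  the embeddings of \<open>E\<close> over \<open>F\<close> are the elements of the Galois group.\<close>

definition rel_trace :: "complex set \<Rightarrow> complex set \<Rightarrow> complex \<Rightarrow> complex" where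
  "rel_trace E F x = (\<Sum>f \<in> {f \<in> embeddings E. \<forall>y\<in>F. f y = y}. f x)"

definition real_embeddings :: "complex set \<Rightarrow> (complex \<Rightarrow> complex) set" where
  "real_embeddings F = {f \<in> embeddings F. f ` F \<subseteq> \<real>}"

definition conj_embedding :: "complex set \<Rightarrow> (complex \<Rightarrow> complex) \<Rightarrow> complex \<Rightarrow> complex" where
  "conj_embedding F f = restrict (\<lambda>x. cnj (f x)) F"

text \<open>\<open>\<tau> 0, \<dots>, \<tau> (r1 - 1)\<close> enumerate the real embeddings, and \<open>\<tau> r1, \<dots>, \<tau> (r1 + r2 - 1)\<close>
  contain exactly one embedding from each conjugate pair of non-real ones.\<close>

definition embedding_enum ::
    "complex set \<Rightarrow> nat \<Rightarrow> nat \<Rightarrow> (nat \<Rightarrow> complex \<Rightarrow> complex) \<Rightarrow> bool" where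
  "embedding_enum F r1 r2 \<tau> \<longleftrightarrow>
     bij_betw \<tau> {..<r1} (real_embeddings F) \<and>
     bij_betw (\<lambda>(i, c). if c then conj_embedding F (\<tau> i) else \<tau> i)
       ({r1..<r1 + r2} \<times> UNIV) (embeddings F - real_embeddings F)"

definition canonical_embedding ::
    "nat \<Rightarrow> nat \<Rightarrow> (nat \<Rightarrow> complex \<Rightarrow> complex) \<Rightarrow> complex \<Rightarrow> real vec" where
  "canonical_embedding r1 r2 \<tau> x = vec (r1 + 2 * r2) (\<lambda>j.
     if j < r1 then Re (\<tau> j x)
     else if even (j - r1) then Re (\<tau> (r1 + (j - r1) div 2) x)
     else Im (\<tau> (r1 + (j - r1) div 2) x))"

text \<open>The basis vectors are the columns of \<open>B\<close>; invertibility makes the lattice full-rank, and the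
  Gram matrix is then \<open>B\<^sup>T * B\<close>.\<close>

definition lattice_basis :: "nat \<Rightarrow> real vec set \<Rightarrow> real mat \<Rightarrow> bool" where
  "lattice_basis n \<Lambda> B \<longleftrightarrow> B \<in> carrier_mat n n \<and> invertible_mat B \<and>
     \<Lambda> = {B *\<^sub>v map_vec real_of_int c | c. c \<in> carrier_vec n}"

definition full_rank_lattice :: "nat \<Rightarrow> real vec set \<Rightarrow> bool" where
  "full_rank_lattice n \<Lambda> \<longleftrightarrow> (\<exists>B. lattice_basis n \<Lambda> B)"

definition lattice_vol :: "nat \<Rightarrow> real vec set \<Rightarrow> real" where
  "lattice_vol n \<Lambda> = (let B = (SOME B. lattice_basis n \<Lambda> B) in sqrt (det (B\<^sup>T * B)))"

definition eucl_norm :: "real vec \<Rightarrow> real" where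
  "eucl_norm v = sqrt (v \<bullet> v)"

definition packing_radius :: "nat \<Rightarrow> real vec set \<Rightarrow> real" where
  "packing_radius n \<Lambda> = (LEAST r. r \<in> eucl_norm ` (\<Lambda> - {0\<^sub>v n})) / 2"

definition center_density :: "nat \<Rightarrow> real vec set \<Rightarrow> real" where
  "center_density n \<Lambda> = packing_radius n \<Lambda> ^ n / lattice_vol n \<Lambda>"

definition generates_units_mod :: "nat \<Rightarrow> int \<Rightarrow> bool" where
  "generates_units_mod p u \<longleftrightarrow>
     generate (units_of (residue_ring (int p))) {u mod int p}
       = carrier (units_of (residue_ring (int p)))"

definition ord_mod :: "nat \<Rightarrow> int \<Rightarrow> nat" where
  "ord_mod p b = ord p (nat (b mod int p))"

definition mu :: "nat \<Rightarrow> int \<Rightarrow> nat \<Rightarrow> int vec" where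
  "mu s \<alpha> i = vec s (\<lambda>j. \<alpha> ^ (j * i))"

definition has_coords :: "nat \<Rightarrow> (complex \<Rightarrow> complex) \<Rightarrow> complex \<Rightarrow> complex \<Rightarrow> int vec \<Rightarrow> bool" where
  "has_coords s \<theta> t x a \<longleftrightarrow>
     a \<in> carrier_vec s \<and> x = (\<Sum>i<s. of_int (a $ i) * (\<theta> ^^ i) t)"

definition module_M ::
    "nat \<Rightarrow> nat \<Rightarrow> complex set \<Rightarrow> (complex \<Rightarrow> complex) \<Rightarrow> complex \<Rightarrow> int \<Rightarrow> complex set" where
  "module_M p s K \<theta> t \<alpha> =
     {x \<in> ring_integers K. \<exists>a. has_coords s \<theta> t x a \<and>
        (\<forall>i \<le> (s - 1) div 2. [a \<bullet> mu s \<alpha> i = 0] (mod int p))}"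

definition module_M_even ::
    "nat \<Rightarrow> nat \<Rightarrow> complex set \<Rightarrow> (complex \<Rightarrow> complex) \<Rightarrow> complex \<Rightarrow> int \<Rightarrow> complex set" where
  "module_M_even p s K \<theta> t \<alpha> =
     {x \<in> module_M p s K \<theta> t \<alpha>. \<exists>a. has_coords s \<theta> t x a \<and> [(\<Sum>i<s. a $ i) = 0] (mod 2)}"

end

(*
  Write an element of the lattice as the combination, with integer coefficients a_i, of the Gauss
  periods theta^i(t).  As s is odd, K is totally real, and orthogonality of the
  p-th roots of unity gives the squared norm of its canonical embedding as
  p * sum a_i^2 - (p - 1)/s * (sum a_i)^2, and determinant p^(s - 1) for the Gram matrix of the
  periods.  The congruences say that half of the discrete Fourier transform of a modulo p vanishes,
  so Parseval's identity makes sum a_i^2, and then, by the parity condition, the squared norm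
  divisible by p * lcm 2 p: this bounds the packing radius.  In the Newton basis
  prod_(l < j) (X - alpha^l) of the polynomials of degree < s the conditions on a become
  divisibility conditions on the single coordinates, so the index of the sublattice, hence the
  volume, can be read off.

  No irreducibility of cyclotomic polynomials is needed: the given automorphism sigma_u already
  provides all conjugations.
*)
theory Submission
  imports Defs "Jordan_Normal_Form.Char_Poly"
begin

section \<open>Roots of unity permuted by a primitive root\<close>

text \<open>Killing half of the frequencies is the balance point. As \<open>s\<close> is odd, each
  pair of opposite frequencies loses at least one member, just enough for Parseval. For odd
  \<open>p\<close> the index is only 2 * p^((s + 1)/2); with the factor p^((s - 1)/2) from the
  periods the volume is 2 * p^s. The radius is at least p / sqrt 2, so all powers of
  \<open>p\<close> cancel and 2^(-(s + 2)/2) is left. The value p = 2 forces s = 1 and is the reason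
  for writing lcm 2 p. The algebraic obstacle is that \<open>K\<close> is known only by its degree.
  The powers of \<sigma> that are trivial on \<open>K\<close> have as exponents the multiples of
  some \<open>n\<close>. A separation argument shows that \<open>K\<close> contains everything fixed
  by \<sigma>^n; the periods and their dual basis under the trace form then give a basis of
  \<open>K\<close>, the equality n = s, and all embeddings. The obstacle on the metric side is that
  \<open>packing_radius\<close> takes a LEAST over real numbers; that a minimum is attained follows
  from the squared norms being integers.\<close>

locale unity_root_orbit =
  fixes p :: nat and \<zeta> :: complex and u :: int
  assumes prime_p: "prime p"
    and primitive: "primitive_unity_root p \<zeta>"
    and u_coprime: "\<not> int p dvd u"
    and u_generates: "\<And>a. \<not> int p dvd a \<Longrightarrow> \<exists>k. [u ^ k = a] (mod int p)"
begin

definition P :: nat where "P = p - 1"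

definition g :: "nat \<Rightarrow> nat" where "g k = nat (u ^ k mod int p)"

text \<open>The conjugates of \<zeta> in the order in which raising \<zeta> to the power
  \<open>u\<close> visits them, so that the automorphism acts by shifting the index, with period
  \<open>P\<close>.\<close>

definition e :: "nat \<Rightarrow> complex" where "e k = \<zeta> ^ g k"

lemma p_gt_1: "p > 1"
  using prime_p prime_gt_1_nat by blast

lemma P_pos: "P > 0"
  using p_gt_1 by (simp add: P_def)

lemma zeta_p: "\<zeta> ^ p = 1"
  using primitive by (simp add: primitive_unity_root_def)

lemma zeta_pow_mod: "\<zeta> ^ (a mod p) = \<zeta> ^ a"
proof -
  have "\<zeta> ^ a = \<zeta> ^ (p * (a div p) + a mod p)" by simp
  also have "\<dots> = \<zeta> ^ (a mod p)"
    by (simp only: power_add power_mult zeta_p) simp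
  finally show ?thesis by simp
qed

lemma zeta_pow_eq_iff: "\<zeta> ^ a = \<zeta> ^ b \<longleftrightarrow> [a = b] (mod p)"
proof
  assume "[a = b] (mod p)"
  then show "\<zeta> ^ a = \<zeta> ^ b" by (metis cong_def zeta_pow_mod)
next
  have nz: "\<zeta> \<noteq> 0" using zeta_p p_gt_1 by (auto simp: zero_power)
  have *: "[a = b] (mod p)" if "\<zeta> ^ a = \<zeta> ^ b" "a \<le> b" for a b
  proof -
    have "\<zeta> ^ (b - a) = 1" using that nz by (simp add: power_diff)
    then have "\<zeta> ^ ((b - a) mod p) = 1" by (simp add: zeta_pow_mod)
    moreover have "(b - a) mod p < p" using p_gt_1 by simp
    ultimately have "\<not> 0 < (b - a) mod p"
      using primitive by (auto simp: primitive_unity_root_def)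
    then have "p dvd b - a" by (simp add: mod_eq_0_iff_dvd)
    then have "b mod p = a mod p" using mod_eq_dvd_iff_nat[OF that(2)] by blast
    then show ?thesis by (simp add: cong_def)
  qed
  assume "\<zeta> ^ a = \<zeta> ^ b"
  then show "[a = b] (mod p)"
    using *[of a b] *[of b a] by (cases "a \<le> b") (auto simp: cong_sym_eq)
qed

lemma int_g: "int (g k) = u ^ k mod int p"
  using p_gt_1 by (simp add: g_def)

lemma g_cong: "[int (g k) = u ^ k] (mod int p)"
  by (simp add: int_g cong_def)

lemma g_add: "[g (j + k) = g j * g k] (mod p)"
proof -
  have "[int (g (j + k)) = int (g j * g k)] (mod int p)"
    using cong_mult[OF g_cong[of j] g_cong[of k]] g_cong[of "j+k"]
    by (metis cong_sym cong_trans of_nat_mult power_add)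
  then show ?thesis unfolding cong_int_iff .
qed

lemma not_dvd_pow: "\<not> int p dvd u ^ k"
  using u_coprime prime_dvd_power[of "int p" u k] prime_p by auto

lemma g_range: "g k \<in> {1..<p}"
proof -
  have "g k < p" using p_gt_1 by (simp add: g_def nat_less_iff)
  moreover have "g k \<noteq> 0"
    using not_dvd_pow[of k] int_g[of k] by (metis dvd_eq_mod_eq_0 of_nat_0)
  ultimately show ?thesis by simp
qed

lemma u_pow: "[u ^ (P) = 1] (mod int p)"
proof -
  have "coprime u (int p)"
    using u_coprime prime_p by (metis coprime_commute prime_imp_coprime prime_nat_int_transfer)
  then show ?thesis
    using residues.euler_theorem[of "int p" u] p_gt_1 totient_prime[OF prime_p]
    by (simp add: residues_def P_def)
qed

lemma g_period: "g (k + (P)) = g k"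
proof -
  have "[u ^ (k + (P)) = u ^ k] (mod int p)"
    unfolding power_add using cong_mult[OF cong_refl[of "u^k"] u_pow] by simp
  then show ?thesis by (simp add: g_def cong_def)
qed

lemma g_mod: "g (k mod P) = g k"
proof -
  have "g (j + (P) * l) = g j" for j l
  proof (induction l)
    case (Suc l)
    have "g (j + (P) * Suc l) = g ((j + (P) * l) + (P))" by (simp add: algebra_simps)
    then show ?case using Suc g_period by simp
  qed simp
  from this[of "k mod P" "k div (P)"] show ?thesis by (simp add: mult.commute)
qed

lemma g_image: "g ` {..<P} = {1..<p}"
proof
  show "g ` {..<P} \<subseteq> {1..<p}" using g_range by auto
  show "{1..<p} \<subseteq> g ` {..<P}"
  proof
    fix a assume a: "a \<in> {1..<p}"
    then have "\<not> int p dvd int a" by (auto dest: zdvd_imp_le)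
    then obtain k where "[u ^ k = int a] (mod int p)" using u_generates by blast
    then have "[int (g k) = int a] (mod int p)" using g_cong cong_trans by blast
    then have "g k = a"
      using a g_range[of k] by (metis atLeastLessThan_iff cong_int_iff cong_less_modulus_unique_nat)
    then have "a = g (k mod P)" by (simp add: g_mod)
    moreover have "k mod P \<in> {..<P}" using P_pos by simp
    ultimately show "a \<in> g ` {..<P}" using imageI[of "k mod P" "{..<P}" g] by simp
  qed
qed

lemma g_bij: "bij_betw g {..<P} {1..<p}"
proof (rule bij_betw_imageI[OF eq_card_imp_inj_on g_image])
  show "card (g ` {..<P}) = card {..<P}" unfolding g_image by (simp add: P_def)
qed simp

lemma g_eq_iff: "g i = g j \<longleftrightarrow> [i = j] (mod P)"
proof -
  have "g i = g j \<longleftrightarrow> g (i mod P) = g (j mod P)" by (simp add: g_mod)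
  also have "\<dots> \<longleftrightarrow> i mod P = j mod P"
    by (rule inj_on_eq_iff[OF bij_betw_imp_inj_on[OF g_bij]]) (use P_pos in auto)
  finally show ?thesis by (simp add: cong_def)
qed

lemma e_eq_iff: "e i = e j \<longleftrightarrow> [i = j] (mod P)"
proof -
  have "[g i = g j] (mod p) \<longleftrightarrow> g i = g j"
    using g_range[of i] g_range[of j] by (auto intro: cong_less_modulus_unique_nat)
  then show ?thesis unfolding e_def zeta_pow_eq_iff using g_eq_iff by simp
qed

lemma e_0: "e 0 = \<zeta>"
  using p_gt_1 by (simp add: e_def g_def)

text \<open>The exponent depends on the shift alone, so a product of shifted conjugates is a power
  of one fixed root of unity and \<open>sum_pow_g\<close> applies to it.\<close>

lemma e_add: "e (j + k) = e j ^ g k"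
  unfolding e_def using g_add by (simp flip: power_mult add: zeta_pow_eq_iff)

lemma e_pow_p: "e k ^ p = 1"
  proof -
  have "e k ^ p = (\<zeta> ^ p) ^ g k" unfolding e_def by (simp only: flip: power_mult) (simp add: mult.commute)
  then show ?thesis by (simp add: zeta_p)
qed

lemma e_period: "e (k + (P)) = e k"
  by (simp add: e_def g_period)

lemma norm_e: "norm (e k) = 1"
proof -
  have "norm (e k) ^ p = 1" by (metis e_pow_p norm_one norm_power)
  then show ?thesis using power_eq_1_iff[of "norm (e k)" p] p_gt_1 by simp
qed

lemma e_cnj: "e k * cnj (e k) = 1"
  using complex_norm_square[of "e k"] by (simp add: norm_e)

lemma e_neq_1: "e k \<noteq> 1"
proof -
  have "\<not> [g k = 0] (mod p)"
    using g_range[of k] by (auto simp: cong_0_iff dest: dvd_imp_le)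
  then show ?thesis unfolding e_def using zeta_pow_eq_iff[of "g k" 0] by simp
qed

text \<open>The exponents run once through the nonzero residues, which leaves a geometric sum of
  length \<open>p\<close> without its constant term.\<close>

lemma sum_pow_g:
  fixes w :: complex
  assumes "w ^ p = 1"
  shows "(\<Sum>k<P. w ^ g k) = (if w = 1 then of_nat p else 0) - 1"
proof -
  have "(\<Sum>k<P. w ^ g k) = (\<Sum>i\<in>{1..<p}. w ^ i)"
    by (rule sum.reindex_bij_betw[OF g_bij])
  also have "\<dots> = (\<Sum>i<p. w ^ i) - 1"
    using p_gt_1 by (simp add: sum.atLeast_Suc_lessThan[of 0 p] lessThan_atLeast0)
  also have "(\<Sum>i<p. w ^ i) = (if w = 1 then of_nat p else 0)"
    using assms by (simp add: sum_gp_strict)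
  finally show ?thesis .
qed

lemma e_orthogonal:
  "(\<Sum>k<P. e (i + k) * cnj (e (j + k))) = (if [i = j] (mod P) then of_nat p else 0) - 1"
proof -
  have "(\<Sum>k<P. e (i + k) * cnj (e (j + k))) = (\<Sum>k<P. (e i * cnj (e j)) ^ g k)"
    by (simp add: e_add power_mult_distrib)
  also have "\<dots> = (if e i * cnj (e j) = 1 then of_nat p else 0) - 1"
    by (rule sum_pow_g) (simp add: power_mult_distrib e_pow_p flip: complex_cnj_power)
  also have "e i * cnj (e j) = 1 \<longleftrightarrow> e i = e j"
    by (metis e_cnj mult.assoc mult.commute mult.right_neutral)
  finally show ?thesis by (simp add: e_eq_iff)
qed

lemma sum_e: "(\<Sum>k<P. e (i + k)) = -1"
  using sum_pow_g[of "e i"] by (simp add: e_add e_pow_p e_neq_1)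

end

section \<open>Gauss periods\<close>

lemma sum_lessThan_times_eq:
  fixes f :: "nat \<Rightarrow> 'a::comm_monoid_add"
  shows "(\<Sum>k<n * m. f k) = (\<Sum>k<n. \<Sum>l<m. f (k + n * l))"
proof -
  have "(\<Sum>k<n * m. f k) = (\<Sum>l<m. sum f {l * n..<l * n + n})"
    by (simp add: sum.nat_group mult.commute)
  also have "\<dots> = (\<Sum>l<m. \<Sum>k<n. f (k + n * l))"
  proof (rule sum.cong[OF refl])
    fix l
    show "sum f {l * n..<l * n + n} = (\<Sum>k<n. f (k + n * l))"
      using sum.shift_bounds_nat_ivl[of f 0 "l * n" n]
      by (simp add: lessThan_atLeast0 add.commute mult.commute)
  qed
  finally show ?thesis by (subst sum.swap) simp
qed

lemma sum_cyclic_shift: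
  fixes f :: "nat \<Rightarrow> 'a::comm_monoid_add"
  assumes "\<And>k. f (k + n) = f k"
  shows "(\<Sum>k<n. f (k + d)) = (\<Sum>k<n. f k)"
proof (induction d)
  case (Suc d)
  show ?case
  proof (cases n)
    case (Suc n')
    have "(\<Sum>k<n. f (k + Suc d)) = (\<Sum>k<n'. f (Suc k + d)) + f (n' + Suc d)"
      by (simp add: Suc)
    also have "f (n' + Suc d) = f (0 + d)"
      using assms[of d] by (simp add: Suc add.commute)
    also have "(\<Sum>k<n'. f (Suc k + d)) + f (0 + d) = (\<Sum>k<n. f (k + d))"
      unfolding Suc by (subst sum.lessThan_Suc_shift) (simp add: add.commute)
    finally show ?thesis using Suc.IH by simp
  qed simp
qed simp

locale gauss_periods = unity_root_orbit +
  fixes n :: nat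
  assumes n_dvd: "n dvd p - 1"
begin

definition m :: nat where "m = (p - 1) div n"

definition t :: "nat \<Rightarrow> complex" where "t i = (\<Sum>l<m. e (i + n * l))"

lemma n_times_m: "n * m = P"
  using n_dvd by (simp add: m_def P_def)

lemma n_pos: "n > 0" and m_pos: "m > 0"
  using n_times_m P_pos by (auto intro: Nat.gr0I)

lemma t_add_n: "t (i + n) = t i"
proof -
  have "t (i + n) = (\<Sum>l<m. e (i + n * (l + 1)))" by (simp add: t_def add.assoc)
  also have "\<dots> = t i"
    unfolding t_def
    by (rule sum_cyclic_shift) (simp add: distrib_left n_times_m e_period flip: add.assoc)
  finally show ?thesis .
qed

lemma t_mod: "t (i mod n) = t i"
proof -
  have "t (j + n * l) = t j" for j l
  proof (induction l)
    case (Suc l)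
    then show ?case using t_add_n[of "j + n * l"] by (simp add: add_ac)
  qed simp
  from this[of "i mod n" "i div n"] show ?thesis by simp
qed

lemma t_cong: "[i = j] (mod n) \<Longrightarrow> t i = t j"
  by (metis cong_def t_mod)

text \<open>The factor with \<open>c\<close> is constant on each residue class modulo
  \<open>n\<close>, and the \<open>e\<close> of one class add up to a period. The function
  \<open>c\<close> is left open to serve both for conjugation and for the constant 1.\<close>

lemma sum_e_times_t: "(\<Sum>k<P. e (i + k) * c (t (j + k))) = (\<Sum>k<n. t (i + k) * c (t (j + k)))"
proof -
  have "(\<Sum>k<P. e (i + k) * c (t (j + k))) = (\<Sum>k<n. \<Sum>l<m. e (i + k + n * l) * c (t (j + k + n * l)))"
    by (simp flip: n_times_m add: sum_lessThan_times_eq add.assoc)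
  also have "\<dots> = (\<Sum>k<n. \<Sum>l<m. e (i + k + n * l) * c (t (j + k)))"
    by (intro sum.cong refl arg_cong2[of _ _ _ _ "(*)"] arg_cong[of _ _ c] t_cong) (simp add: cong_def)
  also have "\<dots> = (\<Sum>k<n. t (i + k) * c (t (j + k)))"
    by (simp add: t_def[of "i + _"] sum_distrib_right)
  finally show ?thesis .
qed

lemma sum_t: "(\<Sum>k<n. t (i + k)) = -1"
  using sum_e_times_t[of i "\<lambda>_. 1" 0] by (simp add: sum_e)

text \<open>The indices \<open>j + n * d\<close> with \<open>d < m\<close> meet each residue modulo
  \<open>P\<close> that lies over \<open>j\<close> modulo \<open>n\<close> exactly once.\<close>

lemma count_translates:
  "(\<Sum>d<m. if [i = j + n * d] (mod P) then c else 0) = (if [i = j] (mod n) then c else (0::complex))"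
proof (cases "[i = j] (mod n)")
  case False
  have "\<not> [i = j + n * d] (mod P)" for d
  proof
    assume "[i = j + n * d] (mod P)"
    then have "[i = j + n * d] (mod n)" using n_times_m by (metis cong_modulus_mult_nat)
    then show False using False by (simp add: cong_def)
  qed
  then show ?thesis using False by simp
next
  case True
  \<comment> \<open>Adding a multiple of \<open>P\<close> changes no residue and makes the
    difference with \<open>j\<close> nonnegative, so that the quotient \<open>q\<close> is a natural
    number.\<close>
  have "[i + P * j = j] (mod n)"
    using True by (simp add: cong_def mult.assoc flip: n_times_m)
  moreover have "j \<le> i + P * j" using P_pos by (simp add: trans_le_add2)
  ultimately have "n dvd i + P * j - j"
    by (metis cong_def mod_eq_dvd_iff_nat)
  then obtain q where "i + P * j - j = n * q" by blast
  then have q: "i + P * j = j + n * q" using \<open>j \<le> i + P * j\<close> by linarith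
  have iff: "[i = j + n * d] (mod P) \<longleftrightarrow> d = q mod m" if "d < m" for d
  proof -
    have "[i = j + n * d] (mod P) \<longleftrightarrow> [i + P * j = j + n * d] (mod P)" by (simp add: cong_def)
    also have "\<dots> \<longleftrightarrow> [n * q = n * d] (mod n * m)"
      by (simp add: q n_times_m cong_add_lcancel_nat)
    also have "\<dots> \<longleftrightarrow> q mod m = d mod m"
      using n_pos by (simp add: cong_def)
    finally show ?thesis using that by auto
  qed
  have "(\<Sum>d<m. if [i = j + n * d] (mod P) then c else 0) = (\<Sum>d<m. if d = q mod m then c else 0)"
    by (intro sum.cong) (auto simp: iff)
  then show ?thesis using True m_pos by simp
qed

lemma t_orthogonal:
  "(\<Sum>k<n. t (i + k) * cnj (t (j + k))) = (if [i = j] (mod n) then of_nat p else 0) - of_nat m"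
proof -
  have "(\<Sum>k<n. t (i + k) * cnj (t (j + k))) = (\<Sum>k<P. e (i + k) * cnj (t (j + k)))"
    by (rule sum_e_times_t[symmetric])
  also have "\<dots> = (\<Sum>d<m. \<Sum>k<P. e (i + k) * cnj (e (j + n * d + k)))"
    by (subst sum.swap) (simp add: t_def sum_distrib_left add_ac)
  also have "\<dots> = (\<Sum>d<m. if [i = j + n * d] (mod P) then of_nat p else 0) - of_nat m"
    by (simp add: e_orthogonal sum_subtractf)
  finally show ?thesis by (simp add: count_translates)
qed

text \<open>Conjugation is the shift by the \<open>h\<close> with \<open>g h = p - 1\<close>. Being
  an involution it forces \<open>n\<close> to divide 2 * h, and for odd \<open>n\<close> already
  \<open>h\<close>, a shift that the periods do not see.\<close>

lemma cnj_t:
  assumes "odd n"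
  shows "cnj (t i) = t i"
proof -
  have "p - 1 \<in> {1..<p}" using p_gt_1 by simp
  then obtain h where "g h = p - 1" unfolding g_image[symmetric] by force
  then have h: "e h * e 0 = 1"
    using p_gt_1 zeta_p power_minus_mult[of p \<zeta>] unfolding e_0 by (simp add: e_def)
  then have h: "cnj (e 0) = e h"
    by (metis e_cnj mult.assoc mult.commute mult.right_neutral)
  have cnj_e: "cnj (e k) = e (h + k)" for k
    using e_add[of 0 k] by (simp add: e_add[of h k] h)
  have "e (h + h) = e 0" using cnj_e[of h] cnj_e[of 0] h by (metis add_0 complex_cnj_cnj)
  then have "P dvd h + h" by (simp add: e_eq_iff cong_0_iff)
  then have "n dvd 2 * h" using n_times_m by (metis dvd_mult_left mult_2)
  moreover have "coprime n 2" using assms by simp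
  ultimately have "n dvd h" by (simp add: coprime_dvd_mult_right_iff)
  then have "t (i + h) = t i" by (intro t_cong) (auto simp: cong_def)
  moreover have "cnj (t i) = t (i + h)" by (simp add: t_def cnj_e add_ac)
  ultimately show ?thesis by simp
qed

end

section \<open>Automorphisms of the cyclotomic field\<close>

lemma CC_ring: "ring CC"
  by (rule class_ring.ring_axioms)

locale complex_subfield =
  fixes F :: "complex set"
  assumes subfield: "subfield F CC"
begin

lemma zero: "0 \<in> F" and one: "1 \<in> F"
  and add: "x \<in> F \<Longrightarrow> y \<in> F \<Longrightarrow> x + y \<in> F"
  and mult: "x \<in> F \<Longrightarrow> y \<in> F \<Longrightarrow> x * y \<in> F"
  and uminus: "x \<in> F \<Longrightarrow> - x \<in> F"
  using subringE(2,3,5,6,7)[OF subfieldE(1)[OF subfield]]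
  by (simp_all add: class_ring_simps)

lemma diff: "x \<in> F \<Longrightarrow> y \<in> F \<Longrightarrow> x - y \<in> F"
  using add[of x "- y"] uminus[of y] by simp

lemma inverse: "x \<in> F \<Longrightarrow> inverse x \<in> F"
  using ring.subfield_m_inv(1)[OF CC_ring subfield, of x] zero
  by (cases "x = 0") (auto simp: class_ring_simps)

lemma divide: "x \<in> F \<Longrightarrow> y \<in> F \<Longrightarrow> x / y \<in> F"
  by (simp add: divide_inverse inverse mult)

lemma power: "x \<in> F \<Longrightarrow> x ^ k \<in> F"
  by (induction k) (auto intro: one mult)

lemma sum: "(\<And>i. i \<in> A \<Longrightarrow> f i \<in> F) \<Longrightarrow> sum f A \<in> F"
  by (induction A rule: infinite_finite_induct) (auto intro: zero add)

lemma prod: "(\<And>i. i \<in> A \<Longrightarrow> f i \<in> F) \<Longrightarrow> prod f A \<in> F"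
  by (induction A rule: infinite_finite_induct) (auto intro: one mult)

lemma of_nat: "of_nat k \<in> F"
  by (induction k) (auto intro: zero one add)

lemma of_int: "of_int k \<in> F"
  by (cases k) (auto intro: of_nat uminus simp del: of_nat_Suc)

lemma of_rat: "of_rat q \<in> F"
  by (cases q) (simp add: of_rat_rat divide of_int)

lemma Rats: "x \<in> \<rat> \<Longrightarrow> x \<in> F"
  by (auto elim!: Rats_cases intro: of_rat)

end

definition rational_poly :: "complex poly \<Rightarrow> bool" where
  "rational_poly q \<longleftrightarrow> (\<forall>i. coeff q i \<in> \<rat>)"

text \<open>Only the values on \<open>F\<close> are constrained, so that powers of an automorphism
  of \<open>L\<close>, their restrictions and members of \<open>embeddings\<close> all fit.\<close>

locale complex_hom = complex_subfield +
  fixes f :: "complex \<Rightarrow> complex"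
  assumes f_add: "\<And>x y. x \<in> F \<Longrightarrow> y \<in> F \<Longrightarrow> f (x + y) = f x + f y"
    and f_mult: "\<And>x y. x \<in> F \<Longrightarrow> y \<in> F \<Longrightarrow> f (x * y) = f x * f y"
    and f_one: "f 1 = 1"
begin

lemma f_zero: "f 0 = 0"
  using f_add[OF zero zero] by simp

lemma f_uminus: "x \<in> F \<Longrightarrow> f (- x) = - f x"
  using f_add[of x "- x"] uminus[of x] f_zero by (simp add: eq_neg_iff_add_eq_0 add.commute)

lemma f_diff: "x \<in> F \<Longrightarrow> y \<in> F \<Longrightarrow> f (x - y) = f x - f y"
  using f_add[of x "- y"] uminus[of y] f_uminus[of y] by simp

lemma f_inverse: "x \<in> F \<Longrightarrow> f (inverse x) = inverse (f x)"
  using f_mult[of x "inverse x"] inverse[of x] f_one f_zero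
  by (cases "x = 0") (auto intro!: inverse_unique[symmetric])

lemma f_nonzero: "x \<in> F \<Longrightarrow> x \<noteq> 0 \<Longrightarrow> f x \<noteq> 0"
  using f_mult[of x "inverse x"] inverse[of x] f_one by auto

lemma f_inj: "x \<in> F \<Longrightarrow> y \<in> F \<Longrightarrow> f x = f y \<Longrightarrow> x = y"
  using f_nonzero[of "x - y"] f_diff[of x y] diff[of x y] by auto

lemma f_power: "x \<in> F \<Longrightarrow> f (x ^ k) = f x ^ k"
  by (induction k) (auto simp: f_one f_mult power)

lemma f_sum: "(\<And>i. i \<in> A \<Longrightarrow> h i \<in> F) \<Longrightarrow> f (sum h A) = (\<Sum>i\<in>A. f (h i))"
  by (induction A rule: infinite_finite_induct) (auto simp: f_zero f_add sum)

lemma f_prod: "(\<And>i. i \<in> A \<Longrightarrow> h i \<in> F) \<Longrightarrow> f (prod h A) = (\<Prod>i\<in>A. f (h i))"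
  by (induction A rule: infinite_finite_induct) (auto simp: f_one f_mult prod)

lemma f_of_nat: "f (of_nat k) = of_nat k"
  by (induction k) (auto simp: f_zero f_one f_add one of_nat)

lemma f_of_int: "f (of_int k) = of_int k"
  by (cases k) (auto simp: f_of_nat f_uminus of_nat simp del: of_nat_Suc)

lemma f_of_rat: "f (of_rat q) = of_rat q"
proof (cases q)
  case (Fract a b)
  then have "f (of_rat q) = f (of_int a * inverse (of_int b))"
    by (simp add: of_rat_rat divide_inverse)
  also have "\<dots> = of_rat q"
    using Fract by (simp add: f_mult f_inverse f_of_int of_int inverse of_rat_rat divide_inverse)
  finally show ?thesis .
qed

lemma f_Rats: "x \<in> \<rat> \<Longrightarrow> f x = x"
  by (auto elim!: Rats_cases simp: f_of_rat)

lemma f_poly: "rational_poly q \<Longrightarrow> x \<in> F \<Longrightarrow> f (poly q x) = poly q (f x)"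
  by (simp add: poly_altdef f_sum f_mult f_power f_Rats mult power Rats rational_poly_def)

end

lemma embeddings_iff:
  assumes "subfield F CC"
  shows "f \<in> embeddings F \<longleftrightarrow> complex_hom F f \<and> f \<in> extensional F"
  using assms
  by (auto simp: embeddings_def Ring.ring_hom_def complex_hom_def complex_hom_axioms_def
      complex_subfield_def)

locale cyclotomic_field = unity_root_orbit +
  fixes L :: "complex set" and \<sigma> :: "complex \<Rightarrow> complex"
  assumes L_eq: "L = adjoin_Rats \<zeta>"
    and \<sigma>_iso: "\<sigma> \<in> ring_iso (as_ring L) (as_ring L)"
    and \<sigma>_zeta: "\<sigma> \<zeta> = \<zeta> powi u"
begin

sublocale L: complex_subfield L
  unfolding complex_subfield_def L_eq
  using field.generate_field_is_subfield[OF class_field, of "{\<zeta>}"] by simp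

lemma zeta_L: "\<zeta> \<in> L"
  unfolding L_eq by (rule generate_field.incl) simp

lemma e_L: "e k \<in> L"
  by (simp add: e_def L.power zeta_L)

lemma \<sigma>_closed: "x \<in> L \<Longrightarrow> \<sigma> x \<in> L"
  using \<sigma>_iso by (auto simp: ring_iso_def Ring.ring_hom_def)

lemma \<sigma>_pow_closed: "x \<in> L \<Longrightarrow> (\<sigma> ^^ k) x \<in> L"
  by (induction k) (auto intro: \<sigma>_closed)

lemma \<sigma>_hom: "complex_hom L \<sigma>"
  using \<sigma>_iso L.subfield
  by (auto simp: ring_iso_def Ring.ring_hom_def complex_hom_def complex_subfield_def complex_hom_axioms_def)

lemma \<sigma>_pow_hom: "complex_hom L (\<sigma> ^^ k)"
proof (induction k)
  case 0
  show ?case by unfold_locales simp_all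
next
  case (Suc k)
  interpret a: complex_hom L \<sigma> by (rule \<sigma>_hom)
  interpret b: complex_hom L "\<sigma> ^^ k" by (rule Suc)
  show ?case
    by unfold_locales (simp_all add: b.f_add b.f_mult b.f_one a.f_add a.f_mult a.f_one \<sigma>_pow_closed)
qed

sublocale \<sigma>: complex_hom L "\<sigma> ^^ k" for k
  by (rule \<sigma>_pow_hom)

lemma \<sigma>_pow_zeta: "(\<sigma> ^^ k) \<zeta> = e k"
proof (induction k)
  case (Suc k)
  interpret a: complex_hom L \<sigma> by (rule \<sigma>_hom)
  have "\<zeta> \<noteq> 0" using zeta_p p_gt_1 by (auto simp: zero_power)
  \<comment> \<open>As \<open>u\<close> may be negative, the exponent is first reduced to its
    nonnegative residue.\<close>
  have "\<zeta> powi u = \<zeta> powi (int p * (u div int p) + u mod int p)" by simp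
  also have "\<dots> = \<zeta> powi (u mod int p)"
    using \<open>\<zeta> \<noteq> 0\<close> zeta_p
    by (subst power_int_add) (simp_all add: power_int_mult del: mult_div_mod_eq)
  also have "\<dots> = e 1"
    using p_gt_1 by (simp add: e_def g_def power_int_def)
  finally have "\<sigma> \<zeta> = e 1" by (simp add: \<sigma>_zeta)
  then have "\<sigma> (e k) = e 1 ^ g k" by (simp add: e_def[of k] a.f_power zeta_L)
  also have "\<dots> = e (Suc k)" using e_add[of 1 k] by simp
  finally show ?case using Suc by simp
qed (simp add: e_0)

lemma \<sigma>_pow_e: "(\<sigma> ^^ k) (e j) = e (j + k)"
  by (metis \<sigma>_pow_zeta funpow_add add.commute comp_apply)

section \<open>The rational polynomials in \<zeta> already form a field\<close>

definition S :: "complex set" where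
  "S = (\<lambda>q. poly q \<zeta>) ` {q. rational_poly q}"

lemma S_I: "rational_poly q \<Longrightarrow> x = poly q \<zeta> \<Longrightarrow> x \<in> S"
  by (auto simp: S_def)

lemma S_E:
  assumes "x \<in> S"
  obtains q where "rational_poly q" "x = poly q \<zeta>"
  using assms by (auto simp: S_def)

lemma S_subset_L: "S \<subseteq> L"
proof
  fix x assume "x \<in> S"
  then obtain q where q: "rational_poly q" "x = poly q \<zeta>" by (rule S_E)
  then show "x \<in> L"
    unfolding q(2) poly_altdef by (intro L.sum L.mult L.power zeta_L L.Rats) (simp add: rational_poly_def)
qed

lemma S_Rats: "c \<in> \<rat> \<Longrightarrow> c \<in> S"
  by (rule S_I[of "[:c:]"]) (auto simp: rational_poly_def coeff_pCons split: nat.split)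

lemma S_zeta: "\<zeta> \<in> S"
  by (rule S_I[of "[:0, 1:]"]) (auto simp: rational_poly_def coeff_pCons split: nat.split)

lemma S_add:
  assumes "x \<in> S" "y \<in> S"
  shows "x + y \<in> S"
proof -
  obtain q r where "rational_poly q" "rational_poly r" "x = poly q \<zeta>" "y = poly r \<zeta>"
    using assms by (auto elim!: S_E)
  then show ?thesis by (intro S_I[of "q + r"]) (auto simp: rational_poly_def)
qed

lemma S_mult:
  assumes "x \<in> S" "y \<in> S"
  shows "x * y \<in> S"
proof -
  obtain q r where "rational_poly q" "rational_poly r" "x = poly q \<zeta>" "y = poly r \<zeta>"
    using assms by (auto elim!: S_E)
  then show ?thesis
    by (intro S_I[of "q * r"]) (auto simp: rational_poly_def coeff_mult intro!: Rats_sum)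
qed

lemma S_power: "x \<in> S \<Longrightarrow> x ^ k \<in> S"
  using S_Rats[of 1] by (induction k) (auto intro: S_mult)

lemma S_sum: "(\<And>i. i \<in> A \<Longrightarrow> f i \<in> S) \<Longrightarrow> sum f A \<in> S"
  using S_Rats[of 0] by (induction A rule: infinite_finite_induct) (auto intro: S_add)

lemma S_prod: "(\<And>i. i \<in> A \<Longrightarrow> f i \<in> S) \<Longrightarrow> prod f A \<in> S"
  using S_Rats[of 1] by (induction A rule: infinite_finite_induct) (auto intro: S_mult)

lemma \<sigma>_pow_poly: "rational_poly q \<Longrightarrow> (\<sigma> ^^ k) (poly q \<zeta>) = poly q (e k)"
  by (simp add: \<sigma>.f_poly zeta_L \<sigma>_pow_zeta)

lemma S_\<sigma>:
  assumes "x \<in> S"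
  shows "(\<sigma> ^^ k) x \<in> S"
proof -
  obtain q where q: "rational_poly q" "x = poly q \<zeta>" using assms by (rule S_E)
  have "poly q (e k) \<in> S"
    using q(1) unfolding poly_altdef e_def rational_poly_def
    by (intro S_sum S_mult S_power S_zeta S_Rats) auto
  then show ?thesis using q by (simp add: \<sigma>_pow_poly)
qed

lemma \<sigma>_P_S: "x \<in> S \<Longrightarrow> (\<sigma> ^^ P) x = x"
  using e_period[of 0] by (auto simp: \<sigma>_pow_poly e_0 elim!: S_E)

text \<open>A fixed element is the average of its \<open>P\<close> conjugates, and the conjugates of
  a power of \<zeta> add up to p - 1 or to -1.\<close>

lemma fixed_S_Rats:
  assumes "x \<in> S" "\<sigma> x = x"
  shows "x \<in> \<rat>"
proof -
  obtain q where q: "rational_poly q" "x = poly q \<zeta>" using assms(1) by (rule S_E)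
  have fixed: "(\<sigma> ^^ k) x = x" for k by (induction k) (simp_all add: assms(2))
  have "of_nat P * x = (\<Sum>k<P. (\<sigma> ^^ k) x)" by (simp add: fixed)
  also have "\<dots> = (\<Sum>k<P. poly q (e k))" by (simp add: q \<sigma>_pow_poly)
  also have "\<dots> = (\<Sum>i\<le>degree q. coeff q i * (\<Sum>k<P. (e 0 ^ i) ^ g k))"
  proof -
    have pw: "e k ^ i = (e 0 ^ i) ^ g k" for k i
    proof -
      have "e k ^ i = (e 0 ^ g k) ^ i" using e_add[of 0 k] by simp
      then show ?thesis by (simp only: mult.commute flip: power_mult)
    qed
    have "(\<Sum>k<P. poly q (e k)) = (\<Sum>k<P. \<Sum>i\<le>degree q. coeff q i * (e 0 ^ i) ^ g k)"
      unfolding poly_altdef by (intro sum.cong refl arg_cong2[of _ _ _ _ "(*)"] pw)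
    also have "\<dots> = (\<Sum>i\<le>degree q. coeff q i * (\<Sum>k<P. (e 0 ^ i) ^ g k))"
      by (subst sum.swap) (simp add: sum_distrib_left)
    finally show ?thesis .
  qed
  also have "\<dots> \<in> \<rat>"
  proof (rule Rats_sum, rule Rats_mult)
    fix i
    show "coeff q i \<in> \<rat>" using q(1) by (simp add: rational_poly_def)
    have "(e 0 ^ i) ^ p = (e 0 ^ p) ^ i" by (simp flip: power_mult add: mult.commute)
    then have "(e 0 ^ i) ^ p = 1" by (simp add: e_pow_p)
    then show "(\<Sum>k<P. (e 0 ^ i) ^ g k) \<in> \<rat>" using sum_pow_g[of "e 0 ^ i"] by simp
  qed
  finally have "of_nat P * x \<in> \<rat>" .
  from Rats_divide[OF this Rats_of_nat[of P]] show ?thesis using P_pos by simp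
qed

text \<open>Norm argument: the product \<open>N\<close> of all conjugates is fixed by \<sigma>,
  hence rational, and the conjugates other than the first multiply to \<open>N / x\<close>.\<close>

lemma S_inverse:
  assumes "x \<in> S"
  shows "inverse x \<in> S"
proof (cases "x = 0")
  case False
  interpret a: complex_hom L \<sigma> by (rule \<sigma>_hom)
  obtain P' where P': "P = Suc P'" using P_pos gr0_implies_Suc by blast
  have xL: "x \<in> L" using assms S_subset_L by blast
  define z where "z = (\<Prod>k<P'. (\<sigma> ^^ Suc k) x)"
  define N where "N = (\<Prod>k<P. (\<sigma> ^^ k) x)"
  have N_eq: "N = x * z" unfolding N_def z_def P' by (subst prod.lessThan_Suc_shift) simp
  have NS: "N \<in> S" unfolding N_def by (rule S_prod) (rule S_\<sigma>[OF assms])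
  have zS: "z \<in> S" unfolding z_def by (rule S_prod) (rule S_\<sigma>[OF assms])
  have "\<sigma> N = (\<Prod>k<P. (\<sigma> ^^ Suc k) x)"
    unfolding N_def by (subst a.f_prod) (simp_all add: \<sigma>_pow_closed xL)
  also have "\<dots> = z * (\<sigma> ^^ P) x" by (simp only: P' z_def prod.lessThan_Suc)
  also have "\<dots> = N" by (simp add: \<sigma>_P_S[OF assms] N_eq)
  finally have "N \<in> \<rat>" using fixed_S_Rats NS by blast
  have "N \<noteq> 0" unfolding N_def using xL False by (simp add: \<sigma>.f_nonzero)
  then have "inverse x = inverse N * z"
    using N_eq False by (simp add: field_simps)
  moreover have "inverse N \<in> S" using \<open>N \<in> \<rat>\<close> by (intro S_Rats) simp
  ultimately show ?thesis using zS S_mult by simp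
qed (use assms in auto)

lemma L_eq_S: "L = S"
proof
  show "L \<subseteq> S"
  proof
    fix x assume "x \<in> L"
    then show "x \<in> S" unfolding L_eq
    proof (induction rule: generate_field.induct)
      case one
      show ?case using S_Rats[of 1] by simp
    next
      case (incl h)
      then show ?case using S_zeta by simp
    next
      case (a_inv h)
      then show ?case using S_mult[OF S_Rats[of "-1"], of h] by (simp add: class_ring_simps)
    next
      case (m_inv h)
      then show ?case using S_inverse by (simp add: class_ring_simps)
    next
      case (eng_add x y)
      then show ?case using S_add by simp
    next
      case (eng_mult x y)
      then show ?case using S_mult by simp
    qed
  qed
qed (rule S_subset_L)

lemma \<sigma>_P: "x \<in> L \<Longrightarrow> (\<sigma> ^^ P) x = x"
  using \<sigma>_P_S L_eq_S by simp

lemma fixed_Rats: "x \<in> L \<Longrightarrow> \<sigma> x = x \<Longrightarrow> x \<in> \<rat>"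
  using fixed_S_Rats L_eq_S by simp

text \<open>Under the second hypothesis \<sigma> permutes the summands cyclically, so the sum is
  fixed.\<close>

lemma trace_Rats:
  assumes "x \<in> L" "(\<sigma> ^^ k) x = x"
  shows "(\<Sum>i<k. (\<sigma> ^^ i) x) \<in> \<rat>"
proof (cases k)
  case (Suc k')
  interpret a: complex_hom L \<sigma> by (rule \<sigma>_hom)
  have "\<sigma> (\<Sum>i<k. (\<sigma> ^^ i) x) = (\<Sum>i<k. (\<sigma> ^^ Suc i) x)"
    by (subst a.f_sum) (simp_all add: \<sigma>_pow_closed assms(1))
  also have "\<dots> = (\<Sum>i<k'. (\<sigma> ^^ Suc i) x) + (\<sigma> ^^ k) x" by (simp only: Suc sum.lessThan_Suc)
  also have "\<dots> = (\<Sum>i<k. (\<sigma> ^^ i) x)"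
    unfolding assms(2) by (simp only: Suc sum.lessThan_Suc_shift) simp
  finally show ?thesis
    by (intro fixed_Rats L.sum) (simp_all add: \<sigma>_pow_closed assms(1))
qed simp

text \<open>Elements of \<open>L\<close> are polynomials in \<zeta>, so the image of \<zeta>
  determines \<open>f\<close>. It is a \<open>p\<close>-th root of unity, by injectivity not 1,
  hence some \<open>e k\<close>.\<close>

lemma hom_L_eq_\<sigma>_pow:
  assumes "complex_hom L f"
  obtains k where "k < P" "\<And>x. x \<in> L \<Longrightarrow> f x = (\<sigma> ^^ k) x"
proof -
  interpret f: complex_hom L f by (rule assms)
  have inj: "inj_on (\<lambda>i. \<zeta> ^ i) {..<p}"
    by (auto simp: inj_on_def zeta_pow_eq_iff intro: cong_less_modulus_unique_nat)
  have "(\<lambda>i. \<zeta> ^ i) ` {..<p} = {z. z ^ p = 1}"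
  proof (rule card_subset_eq)
    show "finite {z::complex. z ^ p = 1}" using p_gt_1 by (intro finite_roots_unity) simp
    show "(\<lambda>i. \<zeta> ^ i) ` {..<p} \<subseteq> {z. z ^ p = 1}"
      by (auto simp: zeta_p simp flip: power_mult) (simp add: zeta_p mult.commute[of _ p] power_mult)
    show "card ((\<lambda>i. \<zeta> ^ i) ` {..<p}) = card {z::complex. z ^ p = 1}"
      using p_gt_1 by (simp add: card_image[OF inj] card_roots_unity_eq)
  qed
  moreover have "f \<zeta> ^ p = 1"
    using f.f_power[OF zeta_L, of p] by (simp add: zeta_p f.f_one)
  ultimately obtain i where i: "i < p" "f \<zeta> = \<zeta> ^ i" by blast
  have "\<zeta> \<noteq> 1" using e_neq_1[of 0] by (simp add: e_0)
  then have "i \<noteq> 0" using f.f_inj[OF zeta_L L.one] f.f_one i(2) by (metis power_0)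
  then have "i \<in> g ` {..<P}" using i by (simp add: g_image)
  then obtain k where k: "k < P" "i = g k" by blast
  show thesis
  proof
    show "k < P" by (rule k(1))
    fix x assume "x \<in> L"
    then obtain q where "rational_poly q" "x = poly q \<zeta>" unfolding L_eq_S by (rule S_E)
    then show "f x = (\<sigma> ^^ k) x"
      using i k by (simp add: f.f_poly zeta_L \<sigma>_pow_poly e_def)
  qed
qed

end

section \<open>Subfields of the cyclotomic field\<close>

locale cyclotomic_periods = cyclotomic_field + gauss_periods
begin

lemma t_L: "t i \<in> L"
  unfolding t_def by (intro L.sum e_L)

lemma cnj_e: "cnj (e k) = inverse (e k)"
  using e_cnj[of k] by (simp add: inverse_unique)

lemma cnj_t_L: "cnj (t i) \<in> L"
  unfolding t_def by (auto simp: cnj_e intro!: L.sum L.inverse e_L)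

lemma \<sigma>_pow_t: "(\<sigma> ^^ k) (t i) = t (i + k)"
  unfolding t_def by (subst \<sigma>.f_sum) (simp_all add: e_L \<sigma>_pow_e add_ac)

lemma \<sigma>_pow_cnj_t: "(\<sigma> ^^ k) (cnj (t i)) = cnj (t (i + k))"
proof -
  have "(\<sigma> ^^ k) (cnj (t i)) = (\<Sum>l<m. (\<sigma> ^^ k) (inverse (e (i + n * l))))"
    unfolding t_def by (simp add: cnj_e \<sigma>.f_sum L.inverse e_L)
  also have "\<dots> = cnj (t (i + k))"
    unfolding t_def by (simp add: cnj_e \<sigma>.f_inverse e_L \<sigma>_pow_e add_ac)
  finally show ?thesis .
qed

text \<open>These are the coordinates of \<open>y\<close> in the periods:
  \<open>(cnj (t i) - of_nat m) / of_nat p\<close> is the basis dual to the periods under the trace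
  form. Up to the factor \<open>1 / p\<close> each coordinate is the trace of an element fixed by
  \<sigma>^n.\<close>

lemma period_expansion_Rats:
  assumes "y \<in> L" "(\<sigma> ^^ n) y = y"
  shows "(\<Sum>k<n. (cnj (t (i + k)) - of_nat m) * (\<sigma> ^^ k) y) / of_nat p \<in> \<rat>"
proof -
  define w where "w = (cnj (t i) - of_nat m) * y"
  have wL: "w \<in> L" unfolding w_def by (intro L.mult L.diff cnj_t_L L.of_nat assms)
  have w: "(\<sigma> ^^ k) w = (cnj (t (i + k)) - of_nat m) * (\<sigma> ^^ k) y" for k
    unfolding w_def
    by (simp add: \<sigma>.f_mult \<sigma>.f_diff L.diff cnj_t_L L.of_nat assms(1) \<sigma>_pow_cnj_t \<sigma>.f_of_nat)
  have "(\<sigma> ^^ n) w = w" unfolding w by (simp add: assms(2) t_add_n w_def)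
  then have "(\<Sum>k<n. (\<sigma> ^^ k) w) \<in> \<rat>" by (intro trace_Rats wL)
  then show ?thesis unfolding w by (intro Rats_divide) auto
qed

text \<open>As the periods sum to -1, subtracting \<open>of_nat m\<close> cancels the constant in
  \<open>t_orthogonal\<close>, and only the term at \<open>k = 0\<close> survives.\<close>

lemma period_expansion:
  assumes "y \<in> L"
  shows "(\<Sum>i<n. (\<Sum>k<n. (cnj (t (i + k)) - of_nat m) * (\<sigma> ^^ k) y) / of_nat p * t i) = y"
proof -
  have "(\<Sum>i<n. (\<Sum>k<n. (cnj (t (i + k)) - of_nat m) * (\<sigma> ^^ k) y) / of_nat p * t i)
      = (\<Sum>i<n. \<Sum>k<n. (cnj (t (i + k)) - of_nat m) * (\<sigma> ^^ k) y / of_nat p * t i)"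
    by (simp add: sum_distrib_right sum_divide_distrib)
  also have "\<dots> = (\<Sum>k<n. (\<sigma> ^^ k) y / of_nat p *
      ((\<Sum>i<n. t (0 + i) * cnj (t (k + i))) - of_nat m * (\<Sum>i<n. t (0 + i))))"
    by (subst sum.swap)
      (simp add: sum_distrib_left sum_subtractf[symmetric] algebra_simps diff_divide_distrib)
  also have "\<dots> = (\<Sum>k<n. if k = 0 then y else 0)"
  proof (rule sum.cong[OF refl])
    fix k assume "k \<in> {..<n}"
    then have "[0 = k] (mod n) \<longleftrightarrow> k = 0" by (auto simp: cong_def)
    then show "(\<sigma> ^^ k) y / of_nat p *
      ((\<Sum>i<n. t (0 + i) * cnj (t (k + i))) - of_nat m * (\<Sum>i<n. t (0 + i))) = (if k = 0 then y else 0)"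
      unfolding t_orthogonal sum_t using p_gt_1 by simp
  qed
  also have "\<dots> = y" using n_pos by simp
  finally show ?thesis .
qed

text \<open>Nonsingularity of the matrix \<open>t (i + k)\<close> over the complex numbers. Pairing
  with conjugated periods gives p * c j = m * C, with \<open>C\<close> the sum of the coefficients;
  summing over \<open>j\<close> gives p * C = (p - 1) * C.\<close>

lemma period_combination_zero:
  fixes c :: "nat \<Rightarrow> complex"
  assumes "\<And>k. k < n \<Longrightarrow> (\<Sum>i<n. c i * t (i + k)) = 0" "i < n"
  shows "c i = 0"
proof -
  define C where "C = (\<Sum>i<n. c i)"
  have eq: "of_nat p * c j = of_nat m * C" if "j < n" for j
  proof -
    have "0 = (\<Sum>k<n. (\<Sum>i<n. c i * t (i + k)) * cnj (t (j + k)))" by (simp add: assms(1))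
    also have "\<dots> = (\<Sum>i<n. c i * (\<Sum>k<n. t (i + k) * cnj (t (j + k))))"
      by (simp add: sum_distrib_right sum_distrib_left mult.assoc) (rule sum.swap)
    also have "\<dots> = (\<Sum>i<n. (if i = j then of_nat p * c i else 0) - of_nat m * c i)"
    proof (rule sum.cong[OF refl])
      fix i assume "i \<in> {..<n}"
      then have "[i = j] (mod n) \<longleftrightarrow> i = j" using that by (auto simp: cong_def)
      then show "c i * (\<Sum>k<n. t (i + k) * cnj (t (j + k))) =
          (if i = j then of_nat p * c i else 0) - of_nat m * c i"
        unfolding t_orthogonal by (simp add: algebra_simps)
    qed
    also have "\<dots> = of_nat p * c j - of_nat m * C"
      using that by (simp add: sum_subtractf C_def sum_distrib_left)
    finally show ?thesis by simp
  qed
  have "of_nat p * C = (\<Sum>j<n. of_nat p * c j)" by (simp add: C_def sum_distrib_left)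
  also have "\<dots> = of_nat (n * m) * C" by (simp add: eq)
  also have "\<dots> = of_nat (p - 1) * C" by (simp add: n_times_m P_def)
  finally have "C = 0" using p_gt_1 by (simp add: of_nat_diff algebra_simps)
  then show ?thesis using eq[OF assms(2)] p_gt_1 by simp
qed

text \<open>Powers of \<sigma> fix rational coefficients, so one relation yields all its
  shifts.\<close>

lemma periods_independent:
  assumes "\<And>i. i < n \<Longrightarrow> c i \<in> \<rat>" "(\<Sum>i<n. c i * t i) = 0" "i < n"
  shows "c i = 0"
proof (rule period_combination_zero[OF _ assms(3)])
  fix k
  have "(\<Sum>i<n. c i * t (i + k)) = (\<Sum>i<n. (\<sigma> ^^ k) (c i * t i))"
    using assms(1) by (intro sum.cong refl) (simp add: \<sigma>.f_mult L.Rats t_L \<sigma>.f_Rats \<sigma>_pow_t)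
  also have "\<dots> = (\<sigma> ^^ k) (\<Sum>i<n. c i * t i)"
    using assms(1) by (intro \<sigma>.f_sum[symmetric]) (auto intro: L.mult L.Rats t_L)
  finally show "(\<Sum>i<n. c i * t (i + k)) = 0" by (simp add: assms(2) \<sigma>.f_zero)
qed

end

text \<open>The exponents acting trivially on \<open>K\<close> are closed under remainders, so the
  least positive one divides them all, among them \<open>P\<close>. That this \<open>n\<close> is
  the degree of \<open>K\<close> comes out of \<open>dimension_K\<close>.\<close>

lemma (in cyclotomic_field) exists_stabilizer:
  assumes "K \<subseteq> L"
  shows "\<exists>n. n dvd p - 1 \<and> (\<forall>k. (\<forall>x\<in>K. (\<sigma> ^^ k) x = x) \<longleftrightarrow> n dvd k)"
proof -
  define A where "A = {k. \<forall>x\<in>K. (\<sigma> ^^ k) x = x}"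
  have PA: "P \<in> A" using assms \<sigma>_P by (auto simp: A_def)
  define n where "n = (LEAST k. 0 < k \<and> k \<in> A)"
  have n: "0 < n" "n \<in> A" using LeastI[of "\<lambda>k. 0 < k \<and> k \<in> A" P] PA P_pos by (auto simp: n_def)
  have mult: "(\<sigma> ^^ (n * q)) x = x" if "x \<in> K" for q x
    using n(2) that by (induction q) (simp_all add: A_def funpow_add)
  have "k \<in> A \<longleftrightarrow> n dvd k" for k
  proof
    assume "n dvd k"
    then show "k \<in> A" using mult by (auto simp: A_def)
  next
    assume k: "k \<in> A"
    have "k mod n \<in> A" unfolding A_def
    proof safe
      fix x assume x: "x \<in> K"
      have "(\<sigma> ^^ (k mod n + n * (k div n))) x = x" using k x by (simp add: A_def)
      then show "(\<sigma> ^^ (k mod n)) x = x" unfolding funpow_add using mult x by simp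
    qed
    moreover have "k mod n < n" using n(1) by simp
    ultimately have "\<not> 0 < k mod n" using not_less_Least[of "k mod n" "\<lambda>k. 0 < k \<and> k \<in> A"] by (auto simp: n_def)
    then show "n dvd k" by (simp add: mod_eq_0_iff_dvd)
  qed
  then show ?thesis using PA unfolding A_def P_def by blast
qed

section \<open>Galois correspondence for the cyclotomic field\<close>

locale galois_subfield = cyclotomic_periods + K: complex_subfield K for K +
  assumes K_subset: "K \<subseteq> L"
    and stabilizer: "(\<forall>x\<in>K. (\<sigma> ^^ k) x = x) \<longleftrightarrow> n dvd k"
begin

lemma \<sigma>_pow_mod_n:
  assumes "x \<in> K"
  shows "(\<sigma> ^^ (k mod n)) x = (\<sigma> ^^ k) x"
  using assms stabilizer[of n] by (intro funpow_mod_eq) auto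

text \<open>The \<open>L\<close>-span of the functions \<open>k \<mapsto> \<sigma>\<^sup>k x\<close> with \<open>x \<in> K\<close>. It contains the indicator function of
  the multiples of \<open>n\<close>; inserting its expansion into the trace of an element fixed by \<open>\<sigma>\<^sup>n\<close> writes
  that element as a rational combination of elements of \<open>K\<close>.\<close>

inductive_set A :: "(nat \<Rightarrow> complex) set" where
  base: "a \<in> L \<Longrightarrow> x \<in> K \<Longrightarrow> (\<lambda>k. a * (\<sigma> ^^ k) x) \<in> A"
| plus: "\<phi> \<in> A \<Longrightarrow> \<psi> \<in> A \<Longrightarrow> (\<lambda>k. \<phi> k + \<psi> k) \<in> A"

lemma A_mult:
  assumes "\<phi> \<in> A" "a \<in> L" "x \<in> K"
  shows "(\<lambda>k. \<phi> k * (a * (\<sigma> ^^ k) x)) \<in> A"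
  using assms(1)
proof induction
  case (base b y)
  have "(\<lambda>k. b * (\<sigma> ^^ k) y * (a * (\<sigma> ^^ k) x)) = (\<lambda>k. (b * a) * (\<sigma> ^^ k) (y * x))"
    using base assms K_subset by (auto simp: \<sigma>.f_mult algebra_simps subset_iff)
  then show ?case using A.base[of "b * a" "y * x"] base assms by (simp add: L.mult K.mult)
next
  case (plus \<phi> \<psi>)
  then show ?case using A.plus by (simp add: distrib_right)
qed

lemma A_mult_diff:
  assumes "\<phi> \<in> A" "c \<in> L" "d \<in> L" "x \<in> K"
  shows "(\<lambda>k. \<phi> k * (((\<sigma> ^^ k) x - d) * c)) \<in> A"
proof -
  have "(\<lambda>k. \<phi> k * (c * (\<sigma> ^^ k) x) + \<phi> k * ((- d * c) * (\<sigma> ^^ k) 1)) \<in> A"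
    using assms by (intro A.plus A_mult) (auto intro: L.mult L.uminus K.one)
  then show ?thesis by (simp add: \<sigma>.f_one algebra_simps)
qed

lemma A_L: "\<phi> \<in> A \<Longrightarrow> \<phi> k \<in> L"
  by (induction rule: A.induct) (use K_subset in \<open>auto intro!: L.mult L.add \<sigma>_pow_closed\<close>)

lemma A_mod: "\<phi> \<in> A \<Longrightarrow> \<phi> (k mod n) = \<phi> k"
  by (induction rule: A.induct) (auto simp: \<sigma>_pow_mod_n)

text \<open>The argument \<open>P - i\<close> undoes the outer \<sigma>^i: for a generator built
  from \<open>a\<close> and \<open>x\<close> the sum becomes \<open>x\<close> times the trace of
  \<open>a * y\<close>, which is rational.\<close>

lemma A_trace:
  assumes "\<phi> \<in> A" "y \<in> L"
  shows "(\<Sum>i<P. (\<sigma> ^^ i) (\<phi> (P - i) * y)) \<in> K"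
  using assms(1)
proof induction
  case (base a x)
  have x: "x \<in> L" using base K_subset by auto
  have "(\<sigma> ^^ i) (a * (\<sigma> ^^ (P - i)) x * y) = (\<sigma> ^^ i) (a * y) * x" if "i < P" for i
  proof -
    have "(\<sigma> ^^ i) ((\<sigma> ^^ (P - i)) x) = x"
      using that \<sigma>_P[OF x] by (metis comp_apply funpow_add le_add_diff_inverse less_imp_le_nat)
    then show ?thesis
      using base assms(2) x by (simp add: \<sigma>.f_mult L.mult \<sigma>_pow_closed)
  qed
  then have "(\<Sum>i<P. (\<sigma> ^^ i) (a * (\<sigma> ^^ (P - i)) x * y)) = (\<Sum>i<P. (\<sigma> ^^ i) (a * y)) * x"
    by (simp add: sum_distrib_right)
  moreover have "(\<Sum>i<P. (\<sigma> ^^ i) (a * y)) \<in> \<rat>"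
    using base assms(2) by (intro trace_Rats \<sigma>_P L.mult)
  ultimately show ?case using base by (simp add: K.mult K.Rats)
next
  case (plus \<phi> \<psi>)
  then show ?case
    using assms(2)
    by (simp add: distrib_right \<sigma>.f_add A_L L.mult sum.distrib K.add)
qed

text \<open>Interpolation: each \<open>l\<close> contributes a factor that is 1 at 0 and 0 at
  \<open>l\<close>. Its denominator comes from an element of \<open>K\<close> moved by \<sigma>^l,
  which exists as \<open>n\<close> does not divide \<open>l\<close>.\<close>

lemma A_separates:
  assumes "finite B" "B \<subseteq> {1..<n}"
  shows "\<exists>\<phi>\<in>A. \<phi> 0 = 1 \<and> (\<forall>l\<in>B. \<phi> l = 0)"
  using assms
proof (induction B)
  case empty
  have "(\<lambda>k. 1 * (\<sigma> ^^ k) 1) \<in> A" by (intro A.base L.one K.one)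
  then show ?case by (rule bexI[rotated]) simp
next
  case (insert l B)
  then obtain \<phi> where \<phi>: "\<phi> \<in> A" "\<phi> 0 = 1" "\<forall>l\<in>B. \<phi> l = 0" by auto
  have "\<not> n dvd l" using insert.prems by (auto dest: dvd_imp_le)
  then obtain x where x: "x \<in> K" "(\<sigma> ^^ l) x \<noteq> x" using stabilizer by blast
  define \<psi> where "\<psi> = (\<lambda>k. \<phi> k * (((\<sigma> ^^ k) x - (\<sigma> ^^ l) x) * inverse (x - (\<sigma> ^^ l) x)))"
  have "\<psi> \<in> A" unfolding \<psi>_def
    using x K_subset by (intro A_mult_diff \<phi> L.inverse L.diff \<sigma>_pow_closed) auto
  moreover have "\<psi> 0 = 1" using x \<phi> by (simp add: \<psi>_def)
  moreover have "\<psi> j = 0" if "j \<in> insert l B" for j using that \<phi> by (auto simp: \<psi>_def)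
  ultimately show ?case by blast
qed

lemma K_eq_fixed: "K = {y \<in> L. (\<sigma> ^^ n) y = y}"
proof
  show "K \<subseteq> {y \<in> L. (\<sigma> ^^ n) y = y}" using K_subset stabilizer[of n] by auto
  show "{y \<in> L. (\<sigma> ^^ n) y = y} \<subseteq> K"
  proof safe
    fix y assume y: "y \<in> L" "(\<sigma> ^^ n) y = y"
    obtain \<phi> where \<phi>: "\<phi> \<in> A" "\<phi> 0 = 1" "\<forall>l\<in>{1..<n}. \<phi> l = 0"
      using A_separates[of "{1..<n}"] by auto
    have mult: "(\<sigma> ^^ (n * q)) y = y" for q
      using y(2) by (induction q) (simp_all add: funpow_add)
    \<comment> \<open>By periodicity \<phi> is the indicator of the multiples of \<open>n\<close>.
      Of the \<open>P\<close> summands \<open>m\<close> survive, each equal to \<open>y\<close>, so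
      \<open>m * y\<close> lies in \<open>K\<close>.\<close>
    have "(\<sigma> ^^ i) (\<phi> (P - i) * y) = (if n dvd i then y else 0)" if "i < P" for i
    proof -
      have "n dvd P - i \<longleftrightarrow> n dvd i"
        using that n_times_m by (metis dvd_diff_nat dvd_triv_left diff_diff_cancel less_imp_le_nat)
      then have "\<phi> (P - i) = (if n dvd i then 1 else 0)"
        using \<phi> A_mod[OF \<phi>(1), of "P - i"] n_pos
        by (metis (no_types, lifting) One_nat_def Suc_leI atLeastLessThan_iff dvd_eq_mod_eq_0 gr0I mod_less_divisor)
      then show ?thesis using mult by (auto simp: \<sigma>.f_zero)
    qed
    then have "(\<Sum>i<P. (\<sigma> ^^ i) (\<phi> (P - i) * y)) = (\<Sum>i<n * m. if n dvd i then y else 0)"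
      by (simp add: n_times_m)
    also have "\<dots> = (\<Sum>k<n. \<Sum>l<m. if k = 0 then y else 0)"
      unfolding sum_lessThan_times_eq
      by (intro sum.cong refl) (auto simp: dvd_add_left_iff dest: dvd_imp_le)
    also have "\<dots> = of_nat m * y" by (simp add: sum.delta n_pos flip: sum_distrib_left)
    finally have "of_nat m * y \<in> K" using A_trace[OF \<phi>(1) y(1)] by simp
    then have "of_nat m * y / of_nat m \<in> K" by (intro K.divide K.of_nat)
    then show "y \<in> K" using m_pos by simp
  qed
qed

lemma t_K: "t i \<in> K"
  unfolding K_eq_fixed by (simp add: t_L \<sigma>_pow_t t_add_n)

lemma K_expansion:
  assumes "y \<in> K"
  obtains c where "\<And>i. c i \<in> \<rat>" "y = (\<Sum>i<n. c i * t i)"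
proof
  show "(\<Sum>k<n. (cnj (t (i + k)) - of_nat m) * (\<sigma> ^^ k) y) / of_nat p \<in> \<rat>" for i
    using assms by (intro period_expansion_Rats) (auto simp: K_eq_fixed)
  show "y = (\<Sum>i<n. (\<Sum>k<n. (cnj (t (i + k)) - of_nat m) * (\<sigma> ^^ k) y) / of_nat p * t i)"
    using assms by (intro period_expansion[symmetric]) (auto simp: K_eq_fixed)
qed

text \<open>By the expansion in periods an embedding is a combination of the \<open>\<sigma>\<^sup>k\<close>; multiplicativity
  and linear independence leave only one term.\<close>

lemma hom_K_eq_\<sigma>_pow:
  assumes "complex_hom K f"
  obtains k where "k < n" "\<And>x. x \<in> K \<Longrightarrow> f x = (\<sigma> ^^ k) x"
proof -
  interpret f: complex_hom K f by (rule assms)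
  \<comment> \<open>The map \<open>f\<close> fixes the rational coordinates of \<open>y\<close>;
    collecting its value by powers of \<sigma> leaves this as coefficient of \<sigma>^k.\<close>
  define \<nu> where "\<nu> k = (\<Sum>i<n. (cnj (t (i + k)) - of_nat m) / of_nat p * f (t i))" for k
  have f_eq: "f y = (\<Sum>k<n. \<nu> k * (\<sigma> ^^ k) y)" if "y \<in> K" for y
  proof -
    define c where "c i = (\<Sum>k<n. (cnj (t (i + k)) - of_nat m) * (\<sigma> ^^ k) y) / of_nat p" for i
    have c: "c i \<in> \<rat>" for i
      unfolding c_def using that by (intro period_expansion_Rats) (auto simp: K_eq_fixed)
    have "y = (\<Sum>i<n. c i * t i)"
      unfolding c_def using that by (intro period_expansion[symmetric]) (auto simp: K_eq_fixed)
    then have "f y = (\<Sum>i<n. c i * f (t i))"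
      by (simp add: f.f_sum f.f_mult K.mult K.Rats c t_K f.f_Rats)
    also have "\<dots> = (\<Sum>k<n. \<nu> k * (\<sigma> ^^ k) y)"
      unfolding c_def \<nu>_def sum_divide_distrib sum_distrib_right
      by (subst sum.swap) (simp add: mult_ac)
    finally show ?thesis .
  qed
  \<comment> \<open>Expanding both \<open>f (x * t i)\<close> and \<open>f x * f (t i)\<close>
    gives, for every \<open>i\<close>, a vanishing combination of shifted periods.\<close>
  have key: "\<nu> k * (\<sigma> ^^ k) x = \<nu> k * f x" if x: "x \<in> K" and k: "k < n" for x k
  proof -
    have "\<nu> k * ((\<sigma> ^^ k) x - f x) = 0"
    proof (rule period_combination_zero[OF _ k])
      fix i
      have "(\<Sum>k<n. \<nu> k * ((\<sigma> ^^ k) x - f x) * t (k + i))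
          = (\<Sum>k<n. \<nu> k * (\<sigma> ^^ k) (x * t i)) - f x * (\<Sum>k<n. \<nu> k * (\<sigma> ^^ k) (t i))"
        using x K_subset
        by (simp add: \<sigma>.f_mult t_L subset_iff \<sigma>_pow_t sum_distrib_left algebra_simps flip: sum_subtractf)
      also have "\<dots> = f (x * t i) - f x * f (t i)" by (simp add: f_eq x t_K K.mult)
      also have "\<dots> = 0" by (simp add: f.f_mult x t_K)
      finally show "(\<Sum>k<n. \<nu> k * ((\<sigma> ^^ k) x - f x) * t (k + i)) = 0" .
    qed
    then show ?thesis by (simp add: right_diff_distrib)
  qed
  have "(\<Sum>k<n. \<nu> k * (\<sigma> ^^ k) 1) = 1" using f_eq[OF K.one] f.f_one by simp
  then obtain k where "k < n" "\<nu> k \<noteq> 0" by (metis (no_types, lifting) lessThan_iff mult_zero_left sum.neutral zero_neq_one)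
  then have "f x = (\<sigma> ^^ k) x" if "x \<in> K" for x using key[OF that \<open>k < n\<close>] by simp
  then show thesis using that \<open>k < n\<close> by blast
qed

lemma \<sigma>_pow_restrict_inj:
  assumes "i < n" "j < n" "\<And>x. x \<in> K \<Longrightarrow> (\<sigma> ^^ i) x = (\<sigma> ^^ j) x"
  shows "i = j"
proof -
  have "i = j" if ij: "i \<le> j" "j < n" and eq: "\<And>x. x \<in> K \<Longrightarrow> (\<sigma> ^^ i) x = (\<sigma> ^^ j) x" for i j
  proof -
    have "(\<sigma> ^^ (j - i)) x = x" if x: "x \<in> K" for x
    proof (rule \<sigma>.f_inj[of _ _ i])
      have "(\<sigma> ^^ j) x = (\<sigma> ^^ (i + (j - i))) x" using ij by simp
      then show "(\<sigma> ^^ i) ((\<sigma> ^^ (j - i)) x) = (\<sigma> ^^ i) x"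
        unfolding funpow_add using eq[OF x] by simp
    qed (use x K_subset \<sigma>_pow_closed in auto)
    then have "n dvd j - i" using stabilizer by blast
    then show ?thesis using ij by (auto dest: dvd_imp_le)
  qed
  from this[of i j] this[of j i] show ?thesis using assms by (cases "i \<le> j") auto
qed

end

section \<open>Dimension, embeddings and integrality\<close>

lemma subfield_Rats: "subfield \<rat> CC"
proof (rule field.subfieldI'[OF class_field])
  show "subring \<rat> CC"
    by (rule ring.subringI[OF CC_ring]) (auto simp: class_ring_simps)
qed (auto simp: class_ring_simps)

lemma combine_eq_sum:
  "length Ks = length Us \<Longrightarrow> ring.combine CC Ks Us = (\<Sum>i<length Us. Ks ! i * Us ! i)"
proof (induction Ks Us rule: list_induct2)
  case (Cons k Ks u Us)
  then show ?case
    by (simp add: ring.combine.simps[OF CC_ring] sum.lessThan_Suc_shift del: sum.lessThan_Suc)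
qed (simp add: ring.combine.simps[OF CC_ring])

text \<open>This is what identifies the generator \<open>n\<close> of the stabilizer with the
  prescribed degree. The periods serve as basis.\<close>

lemma (in galois_subfield) dimension_K: "ring.dimension CC n \<rat> K"
proof -
  define Us where "Us = map t [0..<n]"
  have len: "length Us = n" by (simp add: Us_def)
  have combine: "ring.combine CC Ks Us = (\<Sum>i<n. Ks ! i * t i)" if "length Ks = n" for Ks
    using that by (subst combine_eq_sum) (auto simp: Us_def)
  have "ring.independent CC \<rat> Us"
  proof (rule ccontr)
    assume "\<not> ring.independent CC \<rat> Us"
    moreover have "set Us \<subseteq> carrier CC" by simp
    ultimately obtain Ks where Ks: "length Ks = length Us" "ring.combine CC Ks Us = \<zero>\<^bsub>CC\<^esub>"
      "set Ks \<subseteq> \<rat>" "set Ks \<noteq> {\<zero>\<^bsub>CC\<^esub>}"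
      using ring.dependent_imp_non_trivial_combine[OF CC_ring subfield_Rats] by metis
    have "Ks ! i = 0" if "i < n" for i
    proof (rule periods_independent[OF _ _ that])
      show "(\<Sum>i<n. Ks ! i * t i) = 0" using Ks combine[of Ks] len by simp
      show "Ks ! j \<in> \<rat>" if "j < n" for j
        using Ks(1,3) len that nth_mem[of j Ks] by auto
    qed
    then have "set Ks \<subseteq> {0}" using Ks(1) len by (auto simp: in_set_conv_nth)
    moreover have "Ks \<noteq> []" using Ks(1) len n_pos by auto
    ultimately show False using Ks(4) by (cases Ks) auto
  qed
  moreover have "ring.Span CC \<rat> Us = K"
  proof -
    have "ring.Span CC \<rat> Us = {ring.combine CC Ks Us | Ks. length Ks = length Us \<and> set Ks \<subseteq> \<rat>}"
      by (rule ring.Span_eq_combine_set_length_version[OF CC_ring subfield_Rats]) simp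
    also have "\<dots> = K"
    proof safe
      fix Ks :: "complex list" assume Ks: "length Ks = length Us" "set Ks \<subseteq> \<rat>"
      then have "\<And>i. i < n \<Longrightarrow> Ks ! i \<in> \<rat>" using len nth_mem[of _ Ks] by auto
      moreover have "length Ks = n" using Ks(1) len by simp
      ultimately show "ring.combine CC Ks Us \<in> K"
        by (simp only: combine) (intro K.sum K.mult K.Rats t_K, simp)
    next
      fix y assume "y \<in> K"
      then obtain c where c: "\<And>i. c i \<in> \<rat>" "y = (\<Sum>i<n. c i * t i)" by (rule K_expansion) blast
      have "y = ring.combine CC (map c [0..<n]) Us" by (subst combine) (simp_all add: c(2))
      then show "\<exists>Ks. y = ring.combine CC Ks Us \<and> length Ks = length Us \<and> set Ks \<subseteq> \<rat>"
        using c(1) len by (intro exI[of _ "map c [0..<n]"]) auto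
    qed
    finally show ?thesis .
  qed
  ultimately show ?thesis
    using ring.dimensionI[OF CC_ring subfield_Rats, of Us K] len by simp
qed

lemma complex_hom_restrict:
  assumes "complex_hom F f"
  shows "complex_hom F (restrict f F)"
proof -
  interpret complex_hom F f by (rule assms)
  show ?thesis by unfold_locales (simp_all add: add mult one f_add f_mult f_one)
qed

lemma complex_hom_subset:
  assumes "complex_hom F f" "complex_subfield G" "G \<subseteq> F"
  shows "complex_hom G f"
  using assms by (auto simp: complex_hom_def complex_hom_axioms_def subset_iff)

section \<open>Embeddings, relative trace and total reality of the subfield\<close>

context galois_subfield
begin

lemma embeddings_K: "embeddings K = (\<lambda>k. restrict (\<sigma> ^^ k) K) ` {..<n}"
proof safe
  fix f assume "f \<in> embeddings K"
  then have f: "complex_hom K f" "f \<in> extensional K"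
    using embeddings_iff[OF K.subfield] by auto
  obtain k where k: "k < n" "\<And>x. x \<in> K \<Longrightarrow> f x = (\<sigma> ^^ k) x"
    by (rule hom_K_eq_\<sigma>_pow[OF f(1)]) blast
  have "f = restrict (\<sigma> ^^ k) K"
    using k(2) f(2) by (auto simp: restrict_def extensional_def)
  then show "f \<in> (\<lambda>k. restrict (\<sigma> ^^ k) K) ` {..<n}" using k(1) by blast
next
  fix k
  show "restrict (\<sigma> ^^ k) K \<in> embeddings K"
    unfolding embeddings_iff[OF K.subfield]
    using complex_hom_restrict[OF complex_hom_subset[OF \<sigma>_pow_hom K.complex_subfield_axioms K_subset]]
    by simp
qed

lemma inj_on_embeddings_K: "inj_on (\<lambda>k. restrict (\<sigma> ^^ k) K) {..<n}"
proof (rule inj_onI)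
  fix i j assume "i \<in> {..<n}" "j \<in> {..<n}" and eq: "restrict (\<sigma> ^^ i) K = restrict (\<sigma> ^^ j) K"
  moreover have "(\<sigma> ^^ i) x = (\<sigma> ^^ j) x" if "x \<in> K" for x
    using fun_cong[OF eq, of x] that by simp
  ultimately show "i = j" by (intro \<sigma>_pow_restrict_inj) auto
qed

text \<open>The embeddings of \<open>L\<close> over \<open>K\<close> are the powers of \<sigma> with
  exponent divisible by \<open>n\<close>, and they send \<zeta> to the summands of the
  period.\<close>

lemma rel_trace_zeta: "rel_trace L K \<zeta> = t 0"
proof -
  define R where "R l = restrict (\<sigma> ^^ (n * l)) L" for l
  have "{f \<in> embeddings L. \<forall>y\<in>K. f y = y} = R ` {..<m}"
  proof safe
    fix f assume "f \<in> embeddings L" and fix_K: "\<forall>y\<in>K. f y = y"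
    then have f: "complex_hom L f" "f \<in> extensional L"
      using embeddings_iff[OF L.subfield] by auto
    obtain k where k: "k < P" "\<And>x. x \<in> L \<Longrightarrow> f x = (\<sigma> ^^ k) x"
      by (rule hom_L_eq_\<sigma>_pow[OF f(1)]) blast
    have "\<forall>x\<in>K. (\<sigma> ^^ k) x = x" using k fix_K K_subset by (metis subset_iff)
    then obtain l where l: "k = n * l" using stabilizer by blast
    then have "l < m" using k(1) by (simp flip: n_times_m)
    moreover have "f = R l"
      using k(2) f(2) l by (auto simp: R_def restrict_def extensional_def)
    ultimately show "f \<in> R ` {..<m}" by blast
  next
    fix l
    show "R l \<in> embeddings L"
      unfolding embeddings_iff[OF L.subfield] R_def
      using complex_hom_restrict[OF \<sigma>_pow_hom] by simp
    fix y assume "y \<in> K"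
    then show "R l y = y" using stabilizer[of "n * l"] K_subset by (auto simp: R_def)
  qed
  moreover have R_zeta: "R l \<zeta> = e (n * l)" for l
    by (simp add: R_def zeta_L \<sigma>_pow_zeta)
  moreover have "inj_on R {..<m}"
  proof (rule inj_onI)
    fix i j assume ij: "i \<in> {..<m}" "j \<in> {..<m}" "R i = R j"
    then have "e (n * i) = e (n * j)" by (metis R_zeta)
    then have "[n * i = n * j] (mod n * m)" by (simp add: e_eq_iff n_times_m)
    then show "i = j" using n_pos ij by (simp add: cong_def)
  qed
  ultimately show ?thesis
    by (simp add: rel_trace_def sum.reindex t_def)
qed

lemma restrict_\<sigma>_pow_t: "((restrict \<sigma> K) ^^ i) (t 0) = t i"
proof (induction i)
  case (Suc i)
  then show ?case using \<sigma>_pow_t[of 1 i] by (simp add: t_K)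
qed simp

lemma \<sigma>_pow_K_real:
  assumes "odd n" "x \<in> K"
  shows "(\<sigma> ^^ k) x \<in> \<real>"
proof -
  obtain c where c: "\<And>i. c i \<in> \<rat>" "x = (\<Sum>i<n. c i * t i)"
    by (rule K_expansion[OF assms(2)]) blast
  have "(\<sigma> ^^ k) x = (\<Sum>i<n. c i * t (i + k))"
    unfolding c(2) by (simp add: \<sigma>.f_sum \<sigma>.f_mult L.mult L.Rats c(1) t_L \<sigma>.f_Rats \<sigma>_pow_t)
  also have "\<dots> \<in> \<real>"
  proof (intro sum_in_Reals Reals_mult)
    show "c i \<in> \<real>" for i using c(1)[of i] by (auto elim!: Rats_cases')
    show "t (i + k) \<in> \<real>" for i using cnj_t[OF assms(1)] by (simp add: Reals_cnj_iff)
  qed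
  finally show ?thesis .
qed

lemma real_embeddings_K:
  assumes "odd n"
  shows "real_embeddings K = embeddings K"
  using \<sigma>_pow_K_real[OF assms] by (auto simp: real_embeddings_def embeddings_K)

lemma embedding_enum_K:
  assumes "odd n" "embedding_enum K r1 r2 \<tau>"
  shows "r1 = n" "r2 = 0" "bij_betw \<tau> {..<n} (embeddings K)"
proof -
  have bij: "bij_betw \<tau> {..<r1} (embeddings K)"
    using assms by (simp add: embedding_enum_def real_embeddings_K)
  have "card (embeddings K) = n"
    by (simp add: embeddings_K card_image[OF inj_on_embeddings_K])
  then show "r1 = n" using bij_betw_same_card[OF bij] by simp
  then show "bij_betw \<tau> {..<n} (embeddings K)" using bij by simp
  \<comment> \<open>No embedding is left for the second bijection of \<open>embedding_enum\<close>,
    so its index set is empty.\<close>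
  have "{r1..<r1 + r2} \<times> (UNIV :: bool set) = {}"
    using assms by (simp add: embedding_enum_def real_embeddings_K bij_betw_def)
  then show "r2 = 0" by auto
qed

end

section \<open>Integrality of integer combinations of periods\<close>

context unity_root_orbit
begin

text \<open>The number is an eigenvalue of the integer circulant matrix with first row
  \<open>b\<close>, for the eigenvector of the powers of \<zeta>, and so a root of a monic integer
  polynomial.\<close>

lemma algebraic_int_zeta_combination:
  fixes b :: "nat \<Rightarrow> int"
  defines "x \<equiv> \<Sum>k<p. of_int (b k) * \<zeta> ^ k"
  shows "algebraic_int x"
proof -
  define A where "A = mat p p (\<lambda>(i, j). b ((j + p - i) mod p))"
  define v where "v = vec p (\<lambda>j. \<zeta> ^ j)"
  have A: "A \<in> carrier_mat p p" by (simp add: A_def)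
  have "map_mat of_int A *\<^sub>v v = x \<cdot>\<^sub>v v"
  proof (rule eq_vecI)
    fix i assume "i < dim_vec (x \<cdot>\<^sub>v v)"
    then have i: "i < p" by (simp add: v_def)
    have shift: "((k + i) mod p + p - i) mod p = k" if "k < p" for k
    proof (cases "k + i < p")
      case False
      then have "(k + i) mod p = k + i - p" using that i by (simp add: le_mod_geq)
      then show ?thesis using that i False by simp
    qed (use that in simp)
    have "(map_mat of_int A *\<^sub>v v) $ i = (\<Sum>j<p. of_int (b ((j + p - i) mod p)) * \<zeta> ^ j)"
      using i by (simp add: A_def v_def scalar_prod_def lessThan_atLeast0)
    also have "\<dots> = (\<Sum>k<p. of_int (b k) * \<zeta> ^ ((k + i) mod p))"
      by (rule sum.reindex_bij_witness[of _ "\<lambda>k. (k + i) mod p" "\<lambda>j. (j + p - i) mod p"])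
        (use i shift in \<open>auto simp: mod_simps mod_add_left_eq\<close>)
    also have "\<dots> = (x \<cdot>\<^sub>v v) $ i"
      using i by (simp add: zeta_pow_mod power_add x_def v_def sum_distrib_right mult.assoc)
    finally show "(map_mat of_int A *\<^sub>v v) $ i = (x \<cdot>\<^sub>v v) $ i" .
  qed (simp add: A_def v_def)
  moreover have "v \<noteq> 0\<^sub>v p"
  proof
    assume "v = 0\<^sub>v p"
    then have "v $ 0 = 0" using p_gt_1 by simp
    then show False using p_gt_1 by (simp add: v_def)
  qed
  ultimately have "eigenvalue (map_mat of_int A) x"
    unfolding eigenvalue_def eigenvector_def
    by (intro exI[of _ v]) (auto simp: A_def v_def)
  then have "poly (char_poly (map_mat of_int A)) x = 0"
    using eigenvalue_root_char_poly[of "map_mat of_int A" p x] A by simp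
  then have "poly (map_poly of_int (char_poly A)) x = 0"
    by (simp add: of_int_hom.char_poly_hom[OF A])
  moreover have "lead_coeff (char_poly A) = 1" using degree_monic_char_poly[OF A] by simp
  ultimately show ?thesis unfolding algebraic_int_altdef_ipoly by blast
qed

end

context gauss_periods
begin

text \<open>With \<open>t_K\<close> this puts the combination for any integer vector into
  \<open>ring_integers K\<close>. In the proof \<open>b\<close> collects coefficients by exponent of
  \<zeta>.\<close>

lemma algebraic_int_period_combination:
  "algebraic_int (\<Sum>i<n. of_int (a i) * t i)"
proof -
  define b where "b k = (\<Sum>i<n. \<Sum>l<m. if g (i + n * l) = k then a i else 0)" for k
  have "(\<Sum>k<p. of_int (b k) * \<zeta> ^ k)
      = (\<Sum>i<n. \<Sum>l<m. \<Sum>k<p. if g (i + n * l) = k then of_int (a i) * \<zeta> ^ k else 0)"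
  proof -
    have "(\<Sum>k<p. of_int (b k) * \<zeta> ^ k)
        = (\<Sum>k<p. \<Sum>i<n. \<Sum>l<m. if g (i + n * l) = k then of_int (a i) * \<zeta> ^ k else 0)"
      unfolding b_def
      by (simp add: sum_distrib_right if_distrib[of of_int] if_distrib[of "\<lambda>x. x * _"] cong: if_cong)
    also have "\<dots> = (\<Sum>i<n. \<Sum>k<p. \<Sum>l<m. if g (i + n * l) = k then of_int (a i) * \<zeta> ^ k else 0)"
      by (rule sum.swap)
    finally show ?thesis by (simp only: sum.swap[of _ "{..<m}" "{..<p}"])
  qed
  also have "\<dots> = (\<Sum>i<n. of_int (a i) * t i)"
  proof -
    have "g k < p" for k using g_range[of k] by simp
    then show ?thesis by (simp add: t_def e_def sum_distrib_left)
  qed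
  finally show ?thesis using algebraic_int_zeta_combination[of b] by simp
qed

end

section \<open>Volume and packing radius of a lattice\<close>

lemma upper_triangular_det:
  fixes A :: "'a::comm_ring_1 mat"
  assumes "A \<in> carrier_mat n n" "\<And>i j. j < i \<Longrightarrow> i < n \<Longrightarrow> A $$ (i, j) = 0"
  shows "det A = (\<Prod>i<n. A $$ (i, i))"
proof -
  have "det A = prod_list (diag_mat A)"
    using assms by (intro det_upper_triangular[of _ n]) (auto simp: upper_triangular_def)
  then show ?thesis using assms(1) by (simp add: prod_list_diag_prod lessThan_atLeast0)
qed

lemma lower_triangular_det:
  fixes A :: "'a::comm_ring_1 mat"
  assumes "A \<in> carrier_mat n n" "\<And>i j. i < j \<Longrightarrow> j < n \<Longrightarrow> A $$ (i, j) = 0"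
  shows "det A = (\<Prod>i<n. A $$ (i, i))"
proof -
  have "det A = prod_list (diag_mat A)"
    using assms by (intro det_lower_triangular[of n]) auto
  then show ?thesis using assms(1) by (simp add: prod_list_diag_prod lessThan_atLeast0)
qed

text \<open>Two unimodular row operations. Every column sums to p - n * m = 1, so \<open>U\<close>,
  which replaces the first row by the sum of all rows, creates a row of ones; \<open>V\<close> adds
  \<open>m\<close> times that row to the others and leaves only \<open>p\<close> on their
  diagonal.\<close>

lemma det_scalar_minus_constant:
  fixes p m :: "'a::comm_ring_1"
  assumes n: "n > 0" and nm: "of_nat n * m = p - 1"
  shows "det (mat n n (\<lambda>(i, j). (if i = j then p else 0) - m)) = p ^ (n - 1)"
proof -
  define G where "G = mat n n (\<lambda>(i, j). (if i = j then p else 0) - m)"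
  define U where "U = mat n n (\<lambda>(i, j). if i = 0 \<or> i = j then 1 else (0::'a))"
  define V where "V = mat n n (\<lambda>(i, j). if i = j then 1 else if j = 0 then m else (0::'a))"
  define R where "R = mat n n (\<lambda>(i, j). if i = 0 then 1 else if i = j then p else (0::'a))"
  define G' where "G' = mat n n (\<lambda>(i, j). if i = 0 then 1 else (if i = j then p else 0) - m)"
  have carrier: "G \<in> carrier_mat n n" "U \<in> carrier_mat n n" "V \<in> carrier_mat n n"
    "R \<in> carrier_mat n n" "G' \<in> carrier_mat n n"
    by (simp_all add: G_def U_def V_def R_def G'_def)
  have "U * G = G'"
  proof (rule eq_matI)
    fix i j assume "i < dim_row G'" "j < dim_col G'"
    then have ij: "i < n" "j < n" by (simp_all add: G'_def)
    have "(U * G) $$ (i, j) = (\<Sum>k<n. (if i = 0 \<or> i = k then 1 else 0) * ((if k = j then p else 0) - m))"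
      using ij by (simp add: U_def G_def scalar_prod_def lessThan_atLeast0)
    also have "\<dots> = G' $$ (i, j)"
    proof (cases "i = 0")
      case True
      then show ?thesis using ij nm by (simp add: G'_def sum_subtractf)
    next
      case False
      then have "(\<Sum>k<n. (if i = 0 \<or> i = k then 1 else 0) * ((if k = j then p else 0) - m))
          = (\<Sum>k<n. if i = k then (if k = j then p else 0) - m else 0)"
        by (intro sum.cong) auto
      then show ?thesis using ij False by (simp add: G'_def)
    qed
    finally show "(U * G) $$ (i, j) = G' $$ (i, j)" .
  qed (simp_all add: U_def G_def G'_def)
  moreover have "V * G' = R"
  proof (rule eq_matI)
    fix i j assume "i < dim_row R" "j < dim_col R"
    then have ij: "i < n" "j < n" by (simp_all add: R_def)
    have "(V * G') $$ (i, j) = (\<Sum>k<n. (if i = k then 1 else if k = 0 then m else 0) *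
        (if k = 0 then 1 else (if k = j then p else 0) - m))"
      using ij by (simp add: V_def G'_def scalar_prod_def lessThan_atLeast0)
    also have "\<dots> = (\<Sum>k<n. (if i = k then (if k = 0 then 1 else (if k = j then p else 0) - m) else 0)
        + (if k = 0 then (if i = 0 then 0 else m) else 0))"
      by (intro sum.cong) auto
    also have "\<dots> = R $$ (i, j)"
      using ij n by (simp add: sum.distrib R_def)
    finally show "(V * G') $$ (i, j) = R $$ (i, j)" .
  qed (simp_all add: V_def G'_def R_def)
  ultimately have "det V * (det U * det G) = det R"
    using carrier det_mult by metis
  moreover have "det U = 1"
    by (subst upper_triangular_det[OF carrier(2)]) (simp_all add: U_def)
  moreover have "det V = 1"
    by (subst lower_triangular_det[OF carrier(3)]) (simp_all add: V_def)
  moreover have "det R = p ^ (n - 1)"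
  proof -
    obtain n' where n': "n = Suc n'" using n gr0_implies_Suc by blast
    have "det R = (\<Prod>i<n. if i = 0 then 1 else p)"
      by (subst upper_triangular_det[OF carrier(4)]) (auto simp: R_def intro!: prod.cong)
    then show ?thesis unfolding n' by (subst (asm) prod.lessThan_Suc_shift) simp
  qed
  ultimately show ?thesis by (simp add: G_def)
qed

lemma lattice_basis_det_nonzero:
  assumes "lattice_basis n \<Lambda> B"
  shows "det B \<noteq> 0"
proof -
  have B: "B \<in> carrier_mat n n" "invertible_mat B" using assms by (auto simp: lattice_basis_def)
  then obtain C where C: "inverts_mat B C" "inverts_mat C B" by (auto simp: invertible_mat_def)
  then have BC: "B * C = 1\<^sub>m n" and CB: "C * B = 1\<^sub>m (dim_row C)"
    using B by (auto simp: inverts_mat_def)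
  have "dim_col C = n" using arg_cong[OF BC, of dim_col] by simp
  moreover have "dim_row C = n" using arg_cong[OF CB, of dim_col] B by simp
  ultimately have "C \<in> carrier_mat n n" by auto
  from det_mult[OF B(1) this] have "det B * det C = 1" using BC by simp
  then show ?thesis by auto
qed

lemma invertible_mat_det_nonzero:
  fixes B :: "'a::field mat"
  assumes B: "B \<in> carrier_mat n n" and "det B \<noteq> 0"
  shows "invertible_mat B"
proof -
  define C where "C = inverse (det B) \<cdot>\<^sub>m adj_mat B"
  have C: "C \<in> carrier_mat n n" using adj_mat(1)[OF B] by (simp add: C_def)
  have "B * C = 1\<^sub>m n" "C * B = 1\<^sub>m n"
    unfolding C_def using assms adj_mat[OF B]
    by (auto simp: mult_smult_distrib mult_smult_assoc_mat[of _ n n _ n] smult_smult_assoc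
      mult_smult_distrib[of _ n n _ n])
  then show ?thesis
    using B C by (auto simp: invertible_mat_def inverts_mat_def)
qed

lemma map_vec_unit_vec: "map_vec real_of_int (unit_vec n j) = unit_vec n j"
  by (rule eq_vecI) (auto simp: unit_vec_def)

lemma lattice_basis_change:
  assumes B: "lattice_basis n \<Lambda> B" and B': "lattice_basis n \<Lambda> B'"
  obtains U :: "int mat" where "U \<in> carrier_mat n n" "B' = B * map_mat real_of_int U"
proof -
  have carrier: "B \<in> carrier_mat n n" "B' \<in> carrier_mat n n"
    using B B' by (auto simp: lattice_basis_def)
  have "\<exists>c. c \<in> carrier_vec n \<and> col B' j = B *\<^sub>v map_vec real_of_int c" if "j < n" for j
  proof -
    have "col B' j = B' *\<^sub>v map_vec real_of_int (unit_vec n j)"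
      unfolding map_vec_unit_vec using carrier that by (intro eq_vecI) auto
    then have "col B' j \<in> \<Lambda>" using B' by (force simp: lattice_basis_def)
    then show ?thesis using B by (auto simp: lattice_basis_def)
  qed
  then obtain c where c: "\<And>j. j < n \<Longrightarrow> c j \<in> carrier_vec n"
    "\<And>j. j < n \<Longrightarrow> col B' j = B *\<^sub>v map_vec real_of_int (c j)"
    by metis
  define U where "U = mat n n (\<lambda>(i, j). c j $ i)"
  have U: "U \<in> carrier_mat n n" by (simp add: U_def)
  have col_U: "col (map_mat real_of_int U) j = map_vec real_of_int (c j)" if "j < n" for j
    using c(1)[OF that] that by (auto simp: U_def)
  have "B' = B * map_mat real_of_int U"
  proof (rule mat_col_eqI)
    fix j assume "j < dim_col (B * map_mat real_of_int U)"
    then have j: "j < n" by (simp add: U_def)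
    have "col (B * map_mat real_of_int U) j = B *\<^sub>v col (map_mat real_of_int U) j"
      using carrier U j by (intro col_mult2[of _ n n _ n]) auto
    then show "col B' j = col (B * map_mat real_of_int U) j"
      by (simp only: c(2)[OF j] col_U[OF j])
  qed (use carrier U in auto)
  then show thesis using that U by blast
qed

text \<open>The volume is defined through a basis picked by SOME. The integer base changes in both
  directions have determinants with product 1, so the pick does not matter.\<close>

lemma lattice_vol_eq:
  assumes "lattice_basis n \<Lambda> B"
  shows "lattice_vol n \<Lambda> = sqrt (det (B\<^sup>T * B))"
proof -
  define B' where "B' = (SOME B. lattice_basis n \<Lambda> B)"
  have B': "lattice_basis n \<Lambda> B'" unfolding B'_def using assms by (rule someI)
  have carrier: "B \<in> carrier_mat n n" "B' \<in> carrier_mat n n"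
    using assms B' by (auto simp: lattice_basis_def)
  obtain U where U: "U \<in> carrier_mat n n" "B' = B * map_mat real_of_int U"
    by (rule lattice_basis_change[OF assms B'])
  obtain V where V: "V \<in> carrier_mat n n" "B = B' * map_mat real_of_int V"
    by (rule lattice_basis_change[OF B' assms])
  have dU: "det B' = det B * real_of_int (det U)"
    using U carrier by (simp add: det_mult[of _ n])
  have dV: "det B = det B' * real_of_int (det V)"
    using V carrier by (simp add: det_mult[of _ n])
  have "det B * (real_of_int (det U) * real_of_int (det V)) = det B"
    by (metis dU dV mult.assoc)
  then have "real_of_int (det U * det V) = 1" using lattice_basis_det_nonzero[OF assms] by simp
  then have "det U * det V = 1" by linarith
  then have "\<bar>det U\<bar> = 1" by (metis abs_zmult_eq_1 abs_one)
  then have "(real_of_int (det U))\<^sup>2 = 1" by (simp add: power2_eq_1_iff abs_if split: if_splits)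
  moreover have "det (C\<^sup>T * C) = (det C)\<^sup>2" if "C \<in> carrier_mat n n" for C :: "real mat"
    using that by (simp add: det_mult[of _ n] det_transpose power2_eq_square)
  ultimately show ?thesis
    using carrier dU by (simp add: lattice_vol_def power_mult_distrib flip: B'_def)
qed

text \<open>A LEAST over real numbers has the intended meaning only if the minimum is attained.
  Asking for natural squared norms secures this by well-ordering of the naturals.\<close>

lemma packing_radius_ge:
  assumes basis: "lattice_basis n \<Lambda> B" and n: "n > 0"
    and norms: "\<And>v. v \<in> \<Lambda> \<Longrightarrow> v \<noteq> 0\<^sub>v n \<Longrightarrow> \<exists>N. v \<bullet> v = real N \<and> M \<le> N"
  shows "packing_radius n \<Lambda> \<ge> sqrt (real M) / 2"
proof -
  have B: "B \<in> carrier_mat n n" using basis by (simp add: lattice_basis_def)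
  \<comment> \<open>The minimum must range over a nonempty set; the first basis vector is a member,
    as \<open>B\<close> is nonsingular.\<close>
  have "\<exists>v\<in>\<Lambda>. v \<noteq> 0\<^sub>v n"
  proof (rule ccontr)
    assume "\<not> ?thesis"
    moreover have "B *\<^sub>v map_vec real_of_int (unit_vec n 0) \<in> \<Lambda>"
      using basis by (force simp: lattice_basis_def)
    ultimately have "B *\<^sub>v map_vec real_of_int (unit_vec n 0) = 0\<^sub>v n" by blast
    then have "B *\<^sub>v unit_vec n 0 = 0\<^sub>v n" by (simp add: map_vec_unit_vec)
    moreover have "unit_vec n 0 \<noteq> (0\<^sub>v n :: real vec)" using n by (metis index_unit_vec(1) index_zero_vec(1) zero_neq_one)
    ultimately have "det B = 0"
      using det_0_iff_vec_prod_zero_field[OF B] by (metis unit_vec_carrier)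
    then show False using lattice_basis_det_nonzero[OF basis] by simp
  qed
  then obtain v0 where v0: "v0 \<in> \<Lambda>" "v0 \<noteq> 0\<^sub>v n" by blast
  define Q where "Q N \<longleftrightarrow> (\<exists>v\<in>\<Lambda> - {0\<^sub>v n}. v \<bullet> v = real N)" for N
  have "\<exists>N. Q N" using v0 norms[OF v0] by (auto simp: Q_def)
  define N where "N = (LEAST N. Q N)"
  have QN: "Q N" unfolding N_def using \<open>\<exists>N. Q N\<close> by (rule LeastI_ex)
  then obtain v where v: "v \<in> \<Lambda>" "v \<noteq> 0\<^sub>v n" "v \<bullet> v = real N" by (auto simp: Q_def)
  have "(LEAST r. r \<in> eucl_norm ` (\<Lambda> - {0\<^sub>v n})) = sqrt (real N)"
  proof (rule Least_equality)
    show "sqrt (real N) \<in> eucl_norm ` (\<Lambda> - {0\<^sub>v n})"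
      using v by (auto simp: eucl_norm_def intro!: image_eqI[of _ _ v])
    fix r assume "r \<in> eucl_norm ` (\<Lambda> - {0\<^sub>v n})"
    then obtain w where w: "w \<in> \<Lambda>" "w \<noteq> 0\<^sub>v n" "r = sqrt (w \<bullet> w)" by (auto simp: eucl_norm_def)
    then obtain N' where "w \<bullet> w = real N'" using norms by blast
    then have "Q N'" using w by (auto simp: Q_def)
    then have "N \<le> N'" unfolding N_def by (rule Least_le)
    then show "sqrt (real N) \<le> r" using w \<open>w \<bullet> w = real N'\<close> by simp
  qed
  moreover have "M \<le> N" using norms[OF v(1,2)] v(3) by auto
  ultimately show ?thesis by (simp add: packing_radius_def)
qed

section \<open>Codewords modulo the prime\<close>

locale root_of_unity_mod =
  fixes p s :: nat and \<alpha> :: int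
  assumes prime_p: "prime p" and odd_s: "odd s" and s_dvd: "s dvd p - 1"
    and \<alpha>_pow: "\<And>k. int p dvd \<alpha> ^ k - 1 \<longleftrightarrow> s dvd k"
begin

abbreviation h :: nat where "h \<equiv> (s - 1) div 2"

lemma p_gt_1: "p > 1"
  using prime_p prime_gt_1_nat by blast

lemma s_pos: "s > 0"
  using odd_s by (auto intro: Nat.gr0I)

lemma not_dvd_\<alpha>: "\<not> int p dvd \<alpha> ^ k"
proof
  assume "int p dvd \<alpha> ^ k"
  then have "int p dvd \<alpha>" using prime_dvd_power[of "int p" \<alpha> k] prime_p by auto
  then have "int p dvd \<alpha> ^ s" using s_pos by (simp add: dvd_power_le[of _ _ 1 s, simplified])
  moreover have "int p dvd \<alpha> ^ s - 1" by (simp add: \<alpha>_pow)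
  ultimately have "int p dvd \<alpha> ^ s - (\<alpha> ^ s - 1)" by (rule dvd_diff)
  then show False using p_gt_1 by simp
qed

lemma p_dvd_mult_iff: "int p dvd a * b \<longleftrightarrow> int p dvd a \<or> int p dvd b"
  using prime_p by (simp add: prime_dvd_mult_iff)

lemma \<alpha>_pow_distinct:
  assumes "i < s" "j < s" "i \<noteq> j"
  shows "\<not> int p dvd \<alpha> ^ i - \<alpha> ^ j"
proof -
  have *: "\<not> int p dvd \<alpha> ^ i - \<alpha> ^ j" if "j < i" "i < s" for i j
  proof -
    have "\<alpha> ^ i - \<alpha> ^ j = \<alpha> ^ j * (\<alpha> ^ (i - j) - 1)"
      using that by (simp add: algebra_simps flip: power_add)
    moreover have "\<not> s dvd i - j" using that by (auto dest: dvd_imp_le)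
    ultimately show ?thesis by (simp add: p_dvd_mult_iff not_dvd_\<alpha> \<alpha>_pow)
  qed
  show ?thesis using *[of i j] *[of j i] assms by (cases "j < i") (auto simp: dvd_diff_commute)
qed

text \<open>Orthogonality of characters modulo \<open>p\<close>; the exponent
  \<open>l * (s - i)\<close> stands for the inverse of \<alpha>^(l * i), so that everything stays in
  the integers.\<close>

lemma character_sum:
  assumes "j < s" "l < s"
  shows "int p dvd (\<Sum>i<s. \<alpha> ^ (j * i) * \<alpha> ^ (l * (s - i))) - (if j = l then int s else 0)"
proof (cases "j = l")
  case True
  have "(\<Sum>i<s. \<alpha> ^ (j * i) * \<alpha> ^ (l * (s - i))) = (\<Sum>i<s. \<alpha> ^ (j * s))"
    using True by (intro sum.cong refl) (simp flip: power_add distrib_left)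
  then have "(\<Sum>i<s. \<alpha> ^ (j * i) * \<alpha> ^ (l * (s - i))) - (if j = l then int s else 0)
      = int s * (\<alpha> ^ (j * s) - 1)"
    using True by (simp add: right_diff_distrib)
  then show ?thesis using \<alpha>_pow[of "j * s"] by simp
next
  case False
  define W where "W = (\<Sum>i<s. \<alpha> ^ (j * i) * \<alpha> ^ (l * (s - i)))"
  \<comment> \<open>Multiplied by \<alpha>^j - \<alpha>^l the sum telescopes; \<open>Suc s\<close>
    makes room for the extra factor \<alpha>^l. The end terms agree modulo \<open>p\<close> because
    \<alpha>^s is 1 there.\<close>
  define T where "T i = \<alpha> ^ (j * i) * \<alpha> ^ (l * (Suc s - i))" for i
  have "(\<alpha> ^ j - \<alpha> ^ l) * W = (\<Sum>i<s. T (Suc i) - T i)"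
    unfolding W_def sum_distrib_left
  proof (rule sum.cong[OF refl])
    fix i assume "i \<in> {..<s}"
    then have "Suc s - i = Suc (s - i)" by auto
    then show "(\<alpha> ^ j - \<alpha> ^ l) * (\<alpha> ^ (j * i) * \<alpha> ^ (l * (s - i))) = T (Suc i) - T i"
      by (simp add: T_def algebra_simps power_add)
  qed
  also have "\<dots> = T s - T 0" by (rule sum_lessThan_telescope)
  also have "\<dots> = \<alpha> ^ l * ((\<alpha> ^ (j * s) - 1) - (\<alpha> ^ (l * s) - 1))"
    by (simp add: T_def algebra_simps power_add)
  finally have "int p dvd (\<alpha> ^ j - \<alpha> ^ l) * W"
    using \<alpha>_pow[of "j * s"] \<alpha>_pow[of "l * s"] by (metis dvd_diff dvd_mult dvd_triv_right)
  then show ?thesis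
    using \<alpha>_pow_distinct[OF assms False] False by (simp add: p_dvd_mult_iff W_def)
qed

text \<open>Parseval's identity for the discrete Fourier transform \<open>i \<mapsto> \<Sum>\<^sub>j a\<^sub>j \<alpha>\<^sup>i\<^sup>j\<close> modulo \<open>p\<close>, all of
  whose products at \<open>i\<close> and \<open>- i\<close> vanish.\<close>

lemma dvd_sum_squares:
  fixes a :: "nat \<Rightarrow> int"
  assumes "\<And>i. i \<le> h \<Longrightarrow> int p dvd (\<Sum>j<s. a j * \<alpha> ^ (j * i))"
  shows "int p dvd (\<Sum>j<s. (a j)\<^sup>2)"
proof -
  define F where "F i = (\<Sum>j<s. a j * \<alpha> ^ (j * i))" for i
  have "int p dvd (\<Sum>i<s. F i * F (s - i))"
  proof (rule dvd_sum)
    fix i assume "i \<in> {..<s}"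
    \<comment> \<open>Here \<open>s = 2 * h + 1\<close> enters: two opposite frequencies cannot both
      exceed \<open>h\<close>.\<close>
    then have "i \<le> h \<or> s - i \<le> h" using odd_s by (auto elim!: oddE)
    then show "int p dvd F i * F (s - i)" using assms unfolding F_def by auto
  qed
  moreover have "(\<Sum>i<s. F i * F (s - i))
      = (\<Sum>j<s. \<Sum>l<s. a j * a l * (\<Sum>i<s. \<alpha> ^ (j * i) * \<alpha> ^ (l * (s - i))))"
  proof -
    have "(\<Sum>i<s. F i * F (s - i))
        = (\<Sum>i<s. \<Sum>j<s. \<Sum>l<s. a j * a l * (\<alpha> ^ (j * i) * \<alpha> ^ (l * (s - i))))"
      by (simp add: F_def sum_product mult_ac)
    also have "\<dots> = (\<Sum>j<s. \<Sum>i<s. \<Sum>l<s. a j * a l * (\<alpha> ^ (j * i) * \<alpha> ^ (l * (s - i))))"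
      by (rule sum.swap)
    also have "\<dots> = (\<Sum>j<s. \<Sum>l<s. \<Sum>i<s. a j * a l * (\<alpha> ^ (j * i) * \<alpha> ^ (l * (s - i))))"
      by (rule sum.cong[OF refl]) (rule sum.swap)
    finally show ?thesis by (simp add: sum_distrib_left)
  qed
  moreover have "int p dvd (\<Sum>j<s. \<Sum>l<s. a j * a l * (\<Sum>i<s. \<alpha> ^ (j * i) * \<alpha> ^ (l * (s - i))))
      - (\<Sum>j<s. \<Sum>l<s. a j * a l * (if j = l then int s else 0))"
    unfolding sum_subtractf[symmetric] right_diff_distrib[symmetric]
    by (intro dvd_sum dvd_mult character_sum) auto
  moreover have "(\<Sum>j<s. \<Sum>l<s. a j * a l * (if j = l then int s else 0)) = int s * (\<Sum>j<s. (a j)\<^sup>2)"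
    by (simp add: if_distrib[of "\<lambda>x. _ * x"] sum_distrib_left power2_eq_square mult_ac cong: if_cong)
  ultimately have "int p dvd int s * (\<Sum>j<s. (a j)\<^sup>2)"
    by (metis dvd_diff_right_iff)
  moreover have "\<not> int p dvd int s"
  proof -
    have "s \<le> p - 1" using s_dvd p_gt_1 by (intro dvd_imp_le) auto
    then show ?thesis using s_pos p_gt_1 by (auto dest: dvd_imp_le simp: int_dvd_int_iff)
  qed
  ultimately show ?thesis by (simp add: p_dvd_mult_iff)
qed

section \<open>Newton basis at the powers of \<alpha>\<close>

definition newton :: "nat \<Rightarrow> int poly" where
  "newton j = (\<Prod>l<j. [:- (\<alpha> ^ l), 1:])"

lemma poly_newton: "poly (newton j) x = (\<Prod>l<j. x - \<alpha> ^ l)"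
  by (simp add: newton_def poly_prod)

lemma degree_newton: "degree (newton j) = j" and lead_coeff_newton: "coeff (newton j) j = 1"
proof -
  have *: "degree (newton j) = j \<and> coeff (newton j) (degree (newton j)) = 1"
  proof (induction j)
    case (Suc j)
    have "newton (Suc j) = newton j * [:- (\<alpha> ^ j), 1:]" by (simp add: newton_def)
    moreover have "newton j \<noteq> 0" and "degree (newton j) = j" and "coeff (newton j) j = 1" using Suc by auto
    ultimately show ?case
      using lead_coeff_mult[of "newton j" "[:- (\<alpha> ^ j), 1:]"]
      by (simp add: degree_mult_eq del: mult_pCons_right)
  qed (simp add: newton_def)
  show "degree (newton j) = j" "coeff (newton j) j = 1" using * by auto
qed

text \<open>Base change from the Newton basis to the monomials. It is unitriangular, as the Newton
  polynomials are monic, so it maps the integer vectors onto themselves.\<close>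

definition newton_mat :: "int mat" where
  "newton_mat = mat s s (\<lambda>(i, j). coeff (newton j) i)"

lemma newton_mat_carrier: "newton_mat \<in> carrier_mat s s"
  by (simp add: newton_mat_def)

lemma det_newton_mat: "det newton_mat = 1"
  by (subst upper_triangular_det[OF newton_mat_carrier])
    (simp_all add: newton_mat_def lead_coeff_newton coeff_eq_0 degree_newton)

text \<open>The dot product with \<open>mu s \<alpha> i\<close> evaluates at \<alpha>^i the
  polynomial whose coefficients are the entries of the vector.\<close>

lemma newton_mat_scalar_mu:
  assumes c: "c \<in> carrier_vec s"
  shows "(newton_mat *\<^sub>v c) \<bullet> mu s \<alpha> i = (\<Sum>j<s. c $ j * (\<Prod>l<j. \<alpha> ^ i - \<alpha> ^ l))"
proof -
  have "(newton_mat *\<^sub>v c) \<bullet> mu s \<alpha> i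
      = (\<Sum>k<s. \<Sum>j<s. c $ j * (coeff (newton j) k * (\<alpha> ^ i) ^ k))"
    using c by (simp add: newton_mat_def mu_def scalar_prod_def lessThan_atLeast0 sum_distrib_right
        sum_distrib_left mult_ac flip: power_mult)
  also have "\<dots> = (\<Sum>j<s. c $ j * (\<Sum>k<s. coeff (newton j) k * (\<alpha> ^ i) ^ k))"
    by (subst sum.swap) (simp add: sum_distrib_left)
  also have "\<dots> = (\<Sum>j<s. c $ j * poly (newton j) (\<alpha> ^ i))"
  proof (intro sum.cong refl arg_cong2[of _ _ _ _ "(*)"])
    fix j assume "j \<in> {..<s}"
    then have "{..j} \<subseteq> {..<s}" by auto
    then have "(\<Sum>k\<le>j. coeff (newton j) k * (\<alpha> ^ i) ^ k) = (\<Sum>k<s. coeff (newton j) k * (\<alpha> ^ i) ^ k)"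
      by (intro sum.mono_neutral_left) (auto simp: coeff_eq_0 degree_newton)
    then show "(\<Sum>k<s. coeff (newton j) k * (\<alpha> ^ i) ^ k) = poly (newton j) (\<alpha> ^ i)"
      by (simp add: poly_altdef degree_newton)
  qed
  finally show ?thesis by (simp add: poly_newton)
qed

text \<open>The system is triangular: \<open>newton j\<close> is exactly 0 at \<alpha>^i for i < j,
  while at \<alpha>^j it is a product of differences prime to \<open>p\<close>. Divisibility is
  therefore passed on one coordinate at a time.\<close>

lemma newton_mat_dvd_iff:
  assumes c: "c \<in> carrier_vec s"
  shows "(\<forall>i\<le>h. int p dvd (newton_mat *\<^sub>v c) \<bullet> mu s \<alpha> i) \<longleftrightarrow> (\<forall>j\<le>h. int p dvd c $ j)"
proof
  have h: "h < s" using s_pos by auto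
  have vanish: "(\<Prod>l<j. \<alpha> ^ i - \<alpha> ^ l) = 0" if "i < j" for i j
    using that by (intro prod_zero) auto
  {
    assume dvd: "\<forall>j\<le>h. int p dvd c $ j"
    show "\<forall>i\<le>h. int p dvd (newton_mat *\<^sub>v c) \<bullet> mu s \<alpha> i"
    proof safe
      fix i assume i: "i \<le> h"
      have "int p dvd c $ j * (\<Prod>l<j. \<alpha> ^ i - \<alpha> ^ l)" for j
      proof (cases "j \<le> h")
        case False
        then have "i < j" using i by simp
        then show ?thesis by (simp only: vanish) simp
      qed (use dvd in simp)
      then show "int p dvd (newton_mat *\<^sub>v c) \<bullet> mu s \<alpha> i"
        unfolding newton_mat_scalar_mu[OF c] by (intro dvd_sum)
    qed
  }
  assume dvd: "\<forall>i\<le>h. int p dvd (newton_mat *\<^sub>v c) \<bullet> mu s \<alpha> i"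
  have "int p dvd c $ j" if "j \<le> h" for j
    using that
  proof (induction j rule: less_induct)
    case (less i)
    have "(\<Sum>j<s. c $ j * (\<Prod>l<j. \<alpha> ^ i - \<alpha> ^ l))
        = (\<Sum>j\<in>{..<s} - {i}. c $ j * (\<Prod>l<j. \<alpha> ^ i - \<alpha> ^ l)) + c $ i * (\<Prod>l<i. \<alpha> ^ i - \<alpha> ^ l)"
      using less.prems h by (subst sum.remove[of _ i]) auto
    moreover have "int p dvd (\<Sum>j\<in>{..<s} - {i}. c $ j * (\<Prod>l<j. \<alpha> ^ i - \<alpha> ^ l))"
    proof (rule dvd_sum)
      fix j assume "j \<in> {..<s} - {i}"
      then show "int p dvd c $ j * (\<Prod>l<j. \<alpha> ^ i - \<alpha> ^ l)"
      proof (cases "j < i")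
        case False
        then have "i < j" using \<open>j \<in> {..<s} - {i}\<close> by simp
        then show ?thesis by (simp only: vanish) simp
      qed (use less in simp)
    qed
    moreover have "int p dvd (\<Sum>j<s. c $ j * (\<Prod>l<j. \<alpha> ^ i - \<alpha> ^ l))"
      using dvd less.prems by (simp flip: newton_mat_scalar_mu[OF c])
    ultimately have "int p dvd c $ i * (\<Prod>l<i. \<alpha> ^ i - \<alpha> ^ l)" by (simp only: dvd_add_right_iff)
    moreover have "\<not> int p dvd (\<Prod>l<i. \<alpha> ^ i - \<alpha> ^ l)"
    proof
      assume "int p dvd (\<Prod>l<i. \<alpha> ^ i - \<alpha> ^ l)"
      then obtain l where "l < i" "int p dvd \<alpha> ^ i - \<alpha> ^ l"
        using prime_p by (auto simp: prime_dvd_prod_iff)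
      then show False using \<alpha>_pow_distinct[of i l] less.prems h by simp
    qed
    ultimately show ?case by (simp add: p_dvd_mult_iff)
  qed
  then show "\<forall>j\<le>h. int p dvd c $ j" by blast
qed

end

section \<open>Density of the code lattice\<close>

lemma vec_scalar_self_eq_0:
  fixes v :: "real vec"
  assumes "v \<in> carrier_vec n" "v \<bullet> v = 0"
  shows "v = 0\<^sub>v n"
proof (rule eq_vecI)
  have "(\<Sum>i<n. v $ i * v $ i) = 0"
    using assms by (simp add: scalar_prod_def lessThan_atLeast0)
  then show "v $ i = 0\<^sub>v n $ i" if "i < dim_vec (0\<^sub>v n :: real vec)" for i
    using that by (subst (asm) sum_nonneg_eq_0_iff) auto
qed (use assms in auto)

lemma gram_scalar_self:
  fixes T :: "real mat"
  assumes T: "T \<in> carrier_mat n n"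
    and gram: "T\<^sup>T * T = mat n n (\<lambda>(i, j). (if i = j then c else 0) - d)"
    and a: "a \<in> carrier_vec n"
  shows "(T *\<^sub>v a) \<bullet> (T *\<^sub>v a) = c * (\<Sum>i<n. (a $ i)\<^sup>2) - d * (\<Sum>i<n. a $ i)\<^sup>2"
proof -
  have "(T *\<^sub>v a) \<bullet> (T *\<^sub>v a) = (T\<^sup>T *\<^sub>v (T *\<^sub>v a)) \<bullet> a"
    using T a by (subst transpose_vec_mult_scalar[of _ n n]) auto
  also have "T\<^sup>T *\<^sub>v (T *\<^sub>v a) = (T\<^sup>T * T) *\<^sub>v a" using T a by simp
  also have "\<dots> \<bullet> a = (\<Sum>i<n. (\<Sum>j<n. ((if i = j then c else 0) - d) * a $ j) * a $ i)"
    unfolding gram using a by (simp add: scalar_prod_def lessThan_atLeast0)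
  also have "\<dots> = (\<Sum>i<n. (c * a $ i - d * (\<Sum>j<n. a $ j)) * a $ i)"
  proof (intro sum.cong refl arg_cong2[of _ _ _ _ "(*)"])
    fix i assume "i \<in> {..<n}"
    then show "(\<Sum>j<n. ((if i = j then c else 0) - d) * a $ j) = c * a $ i - d * (\<Sum>j<n. a $ j)"
      by (simp add: left_diff_distrib sum_subtractf sum_distrib_left if_distrib[of "\<lambda>x. x * _"] cong: if_cong)
  qed
  also have "\<dots> = c * (\<Sum>i<n. (a $ i)\<^sup>2) - d * (\<Sum>i<n. a $ i)\<^sup>2"
  proof -
    define S where "S = (\<Sum>i<n. a $ i)"
    have "(\<Sum>i<n. (c * a $ i - d * S) * a $ i) = c * (\<Sum>i<n. (a $ i)\<^sup>2) - d * S * S"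
      by (simp add: left_diff_distrib sum_subtractf sum_distrib_left power2_eq_square mult.assoc)
        (simp add: S_def sum_distrib_left)
    then show ?thesis by (simp add: S_def power2_eq_square)
  qed
  finally show ?thesis .
qed

context root_of_unity_mod
begin

definition codeword :: "int vec \<Rightarrow> bool" where
  "codeword a \<longleftrightarrow> a \<in> carrier_vec s \<and> (\<forall>i\<le>h. [a \<bullet> mu s \<alpha> i = 0] (mod int p)) \<and>
     [(\<Sum>i<s. a $ i) = 0] (mod 2)"

text \<open>Newton coordinate 0 is the value at 1, the sum of the entries, and so carries the parity
  condition too. Writing \<open>lcm 2 p\<close> covers p = 2 as well.\<close>

definition diag :: "nat \<Rightarrow> int" where
  "diag j = (if j = 0 then int (lcm 2 p) else if j \<le> h then int p else 1)"

definition code_basis :: "int mat" where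
  "code_basis = newton_mat * mat s s (\<lambda>(i, j). if i = j then diag j else 0)"

lemma code_basis_carrier: "code_basis \<in> carrier_mat s s"
  unfolding code_basis_def by (rule mult_carrier_mat[OF newton_mat_carrier]) simp

lemma det_code_basis: "det code_basis = int (lcm 2 p) * int p ^ h"
proof -
  define D where "D = mat s s (\<lambda>(i, j). if i = j then diag j else 0)"
  have D: "D \<in> carrier_mat s s" by (simp add: D_def)
  have "det code_basis = det D"
    unfolding code_basis_def D_def[symmetric]
    by (simp add: det_mult[OF newton_mat_carrier D] det_newton_mat)
  also have "\<dots> = (\<Prod>j<s. diag j)"
    by (subst upper_triangular_det[OF D]) (simp_all add: D_def)
  also have "\<dots> = (\<Prod>j<Suc h. diag j)"
    using s_pos by (intro prod.mono_neutral_right) (auto simp: diag_def)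
  also have "\<dots> = diag 0 * (\<Prod>j<h. diag (Suc j))" by (rule prod.lessThan_Suc_shift)
  also have "(\<Prod>j<h. diag (Suc j)) = (\<Prod>j<h. int p)"
    by (intro prod.cong) (auto simp: diag_def)
  finally show ?thesis by (simp add: diag_def)
qed

lemma scalar_mu_0: "a \<in> carrier_vec s \<Longrightarrow> a \<bullet> mu s \<alpha> 0 = (\<Sum>i<s. a $ i)"
  by (simp add: mu_def scalar_prod_def lessThan_atLeast0)

lemma sum_newton_mat:
  assumes "c \<in> carrier_vec s"
  shows "(\<Sum>i<s. (newton_mat *\<^sub>v c) $ i) = c $ 0"
proof -
  have "(\<Sum>i<s. (newton_mat *\<^sub>v c) $ i) = (\<Sum>j<s. c $ j * (\<Prod>l<j. 1 - \<alpha> ^ l))"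
    using newton_mat_scalar_mu[OF assms, of 0] assms newton_mat_carrier
    by (subst scalar_mu_0[symmetric]) auto
  also have "\<dots> = (\<Sum>j<s. if j = 0 then c $ 0 else 0)"
  proof (rule sum.cong[OF refl])
    fix j :: nat
    have "(\<Prod>l<j. 1 - \<alpha> ^ l) = 0" if "j \<noteq> 0"
      using that by (intro prod_zero bexI[of _ 0]) auto
    then show "c $ j * (\<Prod>l<j. 1 - \<alpha> ^ l) = (if j = 0 then c $ 0 else 0)" by simp
  qed
  finally show ?thesis using s_pos by simp
qed

lemma codeword_newton_iff:
  assumes c: "c \<in> carrier_vec s"
  shows "codeword (newton_mat *\<^sub>v c) \<longleftrightarrow> (\<forall>j<s. diag j dvd c $ j)"
proof -
  have "codeword (newton_mat *\<^sub>v c) \<longleftrightarrow> (\<forall>j\<le>h. int p dvd c $ j) \<and> 2 dvd c $ 0"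
    using newton_mat_carrier c
    by (simp only: codeword_def cong_0_iff newton_mat_dvd_iff[OF c] sum_newton_mat[OF c]
        mult_mat_vec_carrier simp_thms)
  also have "\<dots> \<longleftrightarrow> (\<forall>j<s. diag j dvd c $ j)"
  proof -
    have lcm: "int (lcm 2 p) dvd x \<longleftrightarrow> 2 dvd x \<and> int p dvd x" for x
      by (metis lcm_int_int_eq lcm_least_iff of_nat_numeral)
    have "h < s" using s_pos by auto
    then show ?thesis using s_pos unfolding diag_def
      by (auto simp: lcm split: if_splits)
  qed
  finally show ?thesis .
qed

lemma codewords_eq: "{a. codeword a} = {code_basis *\<^sub>v c | c. c \<in> carrier_vec s}"
proof -
  define D where "D = mat s s (\<lambda>(i, j). if i = j then diag j else 0)"
  have D: "D \<in> carrier_mat s s" by (simp add: D_def)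
  have basis: "code_basis *\<^sub>v c = newton_mat *\<^sub>v (D *\<^sub>v c)" if "c \<in> carrier_vec s" for c
    unfolding code_basis_def D_def[symmetric]
    by (rule assoc_mult_mat_vec[OF newton_mat_carrier D that])
  have Dc: "(D *\<^sub>v c) $ j = diag j * c $ j" if "c \<in> carrier_vec s" "j < s" for c j
    using that by (simp add: D_def scalar_prod_def if_distrib[of "\<lambda>x. x * _"] cong: if_cong)
  show ?thesis
  proof safe
    fix a assume "codeword a"
    then have a: "a \<in> carrier_vec s" by (simp add: codeword_def)
    \<comment> \<open>With determinant 1 the adjugate is an inverse over the integers.\<close>
    define c' where "c' = adj_mat newton_mat *\<^sub>v a"
    have c': "c' \<in> carrier_vec s" using adj_mat(1)[OF newton_mat_carrier] a by (simp add: c'_def)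
    have a_eq: "a = newton_mat *\<^sub>v c'"
      unfolding c'_def using adj_mat[OF newton_mat_carrier] a newton_mat_carrier
      by (subst assoc_mult_mat_vec[symmetric, of _ s s _ s]) (auto simp: det_newton_mat)
    then have dvd: "\<forall>j<s. diag j dvd c' $ j" using \<open>codeword a\<close> codeword_newton_iff[OF c'] by simp
    define c where "c = vec s (\<lambda>j. c' $ j div diag j)"
    have c: "c \<in> carrier_vec s" by (simp add: c_def)
    have "D *\<^sub>v c = c'"
    proof (rule eq_vecI)
      fix j assume "j < dim_vec c'"
      then have j: "j < s" using c' by simp
      then show "(D *\<^sub>v c) $ j = c' $ j" using Dc[OF c j] dvd by (simp add: c_def)
    qed (use c' D in auto)
    then have "a = code_basis *\<^sub>v c" using basis[OF c] a_eq by simp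
    then show "\<exists>c. a = code_basis *\<^sub>v c \<and> c \<in> carrier_vec s" using c by blast
  next
    fix c :: "int vec" assume c: "c \<in> carrier_vec s"
    then have "D *\<^sub>v c \<in> carrier_vec s" using D by simp
    then show "codeword (code_basis *\<^sub>v c)"
      unfolding basis[OF c] using Dc[OF c] codeword_newton_iff by simp
  qed
qed

text \<open>Integers and their squares have the same parity, so the parity condition extends to the
  sum of squares, whose divisibility by \<open>p\<close> is Parseval. In the second term one factor
  supplies \<open>p\<close> and the other \<open>lcm 2 p\<close>.\<close>

lemma codeword_quadratic_form_dvd:
  assumes "codeword a"
  shows "int p * int (lcm 2 p) dvd int p * (\<Sum>i<s. (a $ i)\<^sup>2) - k * (\<Sum>i<s. a $ i)\<^sup>2"
proof -
  have a: "a \<in> carrier_vec s" and cong: "\<And>i. i \<le> h \<Longrightarrow> int p dvd a \<bullet> mu s \<alpha> i"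
    and even: "2 dvd (\<Sum>i<s. a $ i)"
    using assms by (auto simp: codeword_def cong_0_iff)
  have lcm: "int (lcm 2 p) dvd x" if "2 dvd x" "int p dvd x" for x
    using that by (metis lcm_int_int_eq lcm_least of_nat_numeral)
  have "int p dvd (\<Sum>j<s. (a $ j)\<^sup>2)"
  proof (rule dvd_sum_squares)
    fix i assume "i \<le> h"
    then show "int p dvd (\<Sum>j<s. a $ j * \<alpha> ^ (j * i))"
      using cong[of i] a by (simp add: mu_def scalar_prod_def lessThan_atLeast0)
  qed
  moreover have "2 dvd (\<Sum>j<s. (a $ j)\<^sup>2)"
  proof -
    have "2 dvd (\<Sum>j<s. (a $ j)\<^sup>2 - a $ j)" by (intro dvd_sum) simp
    then show ?thesis using even by (simp add: sum_subtractf)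
  qed
  ultimately have squares: "int (lcm 2 p) dvd (\<Sum>j<s. (a $ j)\<^sup>2)" using lcm by blast
  have p: "int p dvd (\<Sum>i<s. a $ i)" using cong[of 0] scalar_mu_0[OF a] by simp
  have "int p * int (lcm 2 p) dvd (\<Sum>i<s. a $ i)\<^sup>2"
    unfolding power2_eq_square by (rule mult_dvd_mono[OF p lcm[OF even p]])
  then have "int p * int (lcm 2 p) dvd k * (\<Sum>i<s. a $ i)\<^sup>2" by (rule dvd_mult)
  then show ?thesis by (rule dvd_diff[OF mult_dvd_mono[OF dvd_refl squares]])
qed

text \<open>The field enters only through the Gram matrix of the periods, which makes the order of
  the embeddings immaterial.\<close>

theorem codeword_lattice_density:
  fixes T :: "real mat"
  assumes T: "T \<in> carrier_mat s s"
    and gram: "T\<^sup>T * T = mat s s (\<lambda>(i, j). (if i = j then real p else 0) - real ((p - 1) div s))"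
    and \<Lambda>: "\<Lambda> = {T *\<^sub>v map_vec real_of_int a | a. codeword a}"
  shows "full_rank_lattice s \<Lambda> \<and> center_density s \<Lambda> \<ge> 1 / 2 powr ((real s + 2) / 2)"
proof -
  define q where "q = lcm 2 p"
  define E where "E = map_mat real_of_int code_basis"
  define B where "B = T * E"
  have E: "E \<in> carrier_mat s s" using code_basis_carrier by (simp add: E_def)
  have B: "B \<in> carrier_mat s s" using T E by (simp add: B_def)
  have "real s * real ((p - 1) div s) = real p - 1"
    using s_dvd p_gt_1 by (simp flip: of_nat_mult add: of_nat_diff)
  then have det_gram: "det (T\<^sup>T * T) = real p ^ (s - 1)"
    unfolding gram using s_pos by (intro det_scalar_minus_constant)
  have det_E: "det E = real q * real p ^ h"
    by (simp add: E_def det_code_basis q_def)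
  have det_T: "(det T)\<^sup>2 = real p ^ (s - 1)"
    using det_gram T by (simp add: det_mult[of _ s] det_transpose power2_eq_square)
  have det_B: "det (B\<^sup>T * B) = (real q * real p ^ (s - 1))\<^sup>2"
  proof -
    have "det B = det T * det E" unfolding B_def by (rule det_mult[OF T E])
    then have "det (B\<^sup>T * B) = (det T)\<^sup>2 * (det E)\<^sup>2"
      using B by (simp add: det_mult[of _ s] det_transpose power2_eq_square)
    also have "\<dots> = (real q)\<^sup>2 * real p ^ (s - 1 + 2 * h)"
      by (simp add: det_T det_E power_mult_distrib power_add power_even_eq mult_ac)
    also have "s - 1 + 2 * h = 2 * (s - 1)" using odd_s by (auto elim!: oddE)
    finally show ?thesis by (simp add: power_mult_distrib power_even_eq)
  qed
  have q_pos: "q > 0" using p_gt_1 by (simp add: q_def lcm_pos_nat)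
  have "det T \<noteq> 0" using det_T p_gt_1 by (auto simp: power_0_left split: if_splits)
  then have "det B \<noteq> 0"
    unfolding B_def using T E det_E q_pos p_gt_1 by (simp add: det_mult[of _ s])
  moreover have "\<Lambda> = {B *\<^sub>v map_vec real_of_int c | c. c \<in> carrier_vec s}"
  proof -
    have eq: "B *\<^sub>v map_vec real_of_int c = T *\<^sub>v map_vec real_of_int (code_basis *\<^sub>v c)"
      if "c \<in> carrier_vec s" for c
      unfolding B_def of_int_hom.mult_mat_vec_hom[OF code_basis_carrier that] E_def[symmetric]
      using T E that by (intro assoc_mult_mat_vec) auto
    have "\<Lambda> = (\<lambda>a. T *\<^sub>v map_vec real_of_int a) ` {a. codeword a}" unfolding \<Lambda> by blast
    also have "\<dots> = (\<lambda>c. T *\<^sub>v map_vec real_of_int (code_basis *\<^sub>v c)) ` carrier_vec s"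
      unfolding codewords_eq by blast
    also have "\<dots> = (\<lambda>c. B *\<^sub>v map_vec real_of_int c) ` carrier_vec s"
      by (rule image_cong[OF refl]) (rule eq[symmetric])
    finally show ?thesis by blast
  qed
  ultimately have basis: "lattice_basis s \<Lambda> B"
    using B by (simp add: lattice_basis_def invertible_mat_det_nonzero)
  have vol: "lattice_vol s \<Lambda> = real q * real p ^ (s - 1)"
    by (simp add: lattice_vol_eq[OF basis] det_B)
  have "packing_radius s \<Lambda> \<ge> sqrt (real (p * q)) / 2"
  proof (rule packing_radius_ge[OF basis s_pos])
    fix v assume v: "v \<in> \<Lambda>" "v \<noteq> 0\<^sub>v s"
    then obtain a where a: "codeword a" "v = T *\<^sub>v map_vec real_of_int a" unfolding \<Lambda> by blast
    then have ca: "a \<in> carrier_vec s" by (simp add: codeword_def)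
    define N where "N = int p * (\<Sum>i<s. (a $ i)\<^sup>2) - int ((p - 1) div s) * (\<Sum>i<s. a $ i)\<^sup>2"
    have vN: "v \<bullet> v = real_of_int N"
      unfolding a(2) using ca by (subst gram_scalar_self[OF T gram]) (auto simp: N_def)
    have cv: "v \<in> carrier_vec s" unfolding a(2) using T ca by simp
    have "v \<bullet> v \<noteq> 0" using vec_scalar_self_eq_0[OF cv] v(2) by blast
    moreover have "v \<bullet> v \<ge> 0" by (simp add: scalar_prod_def sum_nonneg)
    ultimately have "N > 0" using vN by simp
    moreover have "int (p * q) dvd N"
      using codeword_quadratic_form_dvd[OF a(1)] by (simp add: N_def q_def)
    ultimately have "int (p * q) \<le> N" by (rule zdvd_imp_le[rotated])
    then show "\<exists>N. v \<bullet> v = real N \<and> p * q \<le> N"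
      using vN \<open>N > 0\<close> by (intro exI[of _ "nat N"]) (simp add: le_nat_iff)
  qed
  then have "packing_radius s \<Lambda> ^ s \<ge> (sqrt (real (p * q)) / 2) ^ s"
    by (intro power_mono) auto
  then have "center_density s \<Lambda> \<ge> (sqrt (real (p * q)) / 2) ^ s / (real q * real p ^ (s - 1))"
    unfolding center_density_def vol by (intro divide_right_mono) auto
  moreover have "(sqrt (real (p * q)) / 2) ^ s / (real q * real p ^ (s - 1)) \<ge> 1 / 2 powr ((real s + 2) / 2)"
  proof (cases "p = 2")
    case True
    \<comment> \<open>The quotient on the left is now 1/2, above the required 2^(-3/2).\<close>
    then have "s = 1" using s_dvd by simp
    have "(2::real) powr 1 \<le> 2 powr (3 / 2)" by (intro powr_mono) auto
    then show ?thesis using True \<open>s = 1\<close> by (simp add: q_def field_simps)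
  next
    case False
    have "coprime 2 p" using prime_odd_nat[OF prime_p] p_gt_1 False by simp
    then have q: "q = 2 * p" by (simp add: q_def lcm_coprime)
    have "(2::real) powr ((real s + 2) / 2) = (2 powr (1 / 2)) powr real s * 2 powr 1"
      by (simp add: powr_powr powr_add add_divide_distrib)
    also have "\<dots> = 2 * sqrt 2 ^ s" by (simp add: powr_half_sqrt powr_realpow)
    finally have R: "(2::real) powr ((real s + 2) / 2) = 2 * sqrt 2 ^ s" .
    \<comment> \<open>For odd \<open>p\<close> the two sides of the inequality turn out
      equal.\<close>
    have "sqrt (real (p * q)) = real p * sqrt 2"
      by (simp add: q real_sqrt_mult)
    then have "sqrt (real (p * q)) / 2 = real p / sqrt 2"
      by (simp add: field_simps)
    moreover have "real q * real p ^ (s - 1) = 2 * real p ^ s"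
      using s_pos by (simp add: q power_eq_if)
    ultimately show ?thesis unfolding R using p_gt_1 by (simp add: power_divide)
  qed
  ultimately show ?thesis using basis by (auto simp: full_rank_lattice_def)
qed

end

section \<open>Translation of the hypotheses on the generators, and assembly\<close>

lemma generates_units_modD:
  assumes p: "prime p" and gen: "generates_units_mod p u"
  shows "\<not> int p dvd u" and "\<not> int p dvd a \<Longrightarrow> \<exists>k. [u ^ k = a] (mod int p)"
proof -
  define R where "R = residue_ring (int p)"
  interpret residues "int p" R
    using p prime_gt_1_nat by unfold_locales (auto simp: R_def)
  interpret G: group "units_of R" by (rule units_group)
  define u' where "u' = u mod int p"
  have gen: "generate (units_of R) {u'} = Units R"
    using gen by (simp add: generates_units_mod_def R_def u'_def units_of_carrier)
  have units: "Units R = {x. 0 < x \<and> x < int p \<and> coprime x (int p)}" by (rule res_units_eq)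
  have u': "u' \<in> Units R" using generate.incl[of u' "{u'}" "units_of R"] gen by simp
  then show ndvd: "\<not> int p dvd u" by (auto simp: units u'_def dvd_eq_mod_eq_0)
  have u_cong: "[u = u'] (mod int p)" by (simp add: u'_def cong_def)
  have mult: "x \<otimes>\<^bsub>units_of R\<^esub> y = x * y mod int p" for x y
    by (simp add: units_of_mult res_mult_eq)
  have unit_one: "\<one>\<^bsub>units_of R\<^esub> = 1" by (simp add: units_of_one res_one_eq)
  have coprimeI: "coprime x (int p)" if "\<not> int p dvd x" for x
    using prime_imp_coprime[of "int p" x] that p by (simp add: coprime_commute)
  have coprime: "coprime u (int p)" using ndvd by (rule coprimeI)
  have power: "\<exists>k. [u ^ k = x] (mod int p)" if "x \<in> generate (units_of R) {u'}" for x
    using that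
  proof induction
    case one
    then show ?case unfolding unit_one by (intro exI[of _ 0]) simp
  next
    case (incl x)
    then show ?case using u_cong by (intro exI[of _ 1]) simp
  next
    case (inv x)
    define y where "y = inv\<^bsub>units_of R\<^esub> u'"
    have "u' \<otimes>\<^bsub>units_of R\<^esub> y = \<one>\<^bsub>units_of R\<^esub>"
      unfolding y_def using u' by (intro G.r_inv) (simp add: units_of_carrier)
    then have "[u' * y = 1] (mod int p)"
      using p prime_gt_1_nat[of p] by (simp add: mult unit_one cong_def)
    then have "[u * y = 1] (mod int p)" using cong_mult[OF u_cong cong_refl[of y]] cong_trans by blast
    \<comment> \<open>By Euler's theorem the inverse of \<open>u\<close> is itself a power with
      natural exponent.\<close>
    moreover have "[u * u ^ (totient p - 1) = 1] (mod int p)"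
    proof -
      have "totient p > 0" using p prime_gt_0_nat by simp
      then have "u * u ^ (totient p - 1) = u ^ totient p" by (simp flip: power_Suc)
      then show ?thesis using euler_theorem[OF coprime] by simp
    qed
    ultimately have "[u * u ^ (totient p - 1) = u * y] (mod int p)"
      by (metis cong_sym cong_trans)
    then have "[u ^ (totient p - 1) = y] (mod int p)"
      using cong_mult_lcancel[of u "int p"] coprime by blast
    then show ?case using inv by (auto simp: y_def)
  next
    case (eng x y)
    then obtain k l where "[u ^ k = x] (mod int p)" "[u ^ l = y] (mod int p)" by blast
    then have "[u ^ (k + l) = x * y mod int p] (mod int p)"
      unfolding power_add by (simp add: cong_mult cong_mod_right)
    then show ?case unfolding mult by blast
  qed
  assume a: "\<not> int p dvd a"
  have "a mod int p \<in> Units R"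
  proof -
    have "coprime (a mod int p) (int p)"
      using a by (intro coprimeI) (simp add: dvd_mod_iff)
    moreover have "int p > 0" using p prime_gt_0_nat by simp
    then have "0 \<le> a mod int p" "a mod int p < int p" by simp_all
    moreover have "a mod int p \<noteq> 0" using a by (simp add: dvd_eq_mod_eq_0)
    ultimately show ?thesis by (simp add: units)
  qed
  then obtain k where "[u ^ k = a mod int p] (mod int p)" using power gen by blast
  then show "\<exists>k. [u ^ k = a] (mod int p)" by (auto simp: cong_def)
qed

lemma power_primitive_root_order:
  assumes p: "prime p" and s: "s dvd p - 1" and ord: "ord_mod p \<beta> = p - 1"
  shows "int p dvd (\<beta> ^ ((p - 1) div s)) ^ k - 1 \<longleftrightarrow> s dvd k"
proof -
  define b where "b = nat (\<beta> mod int p)"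
  have b: "int b = \<beta> mod int p" using p prime_gt_0_nat[of p] by (simp add: b_def)
  obtain m where m: "p - 1 = s * m" using s by blast
  have "p - 1 > 0" using p prime_gt_1_nat[of p] by simp
  then have "s > 0" "m > 0" using m by (auto intro: Nat.gr0I)
  have "(p - 1) div s = m" using \<open>s > 0\<close> m by simp
  then have "int p dvd (\<beta> ^ ((p - 1) div s)) ^ k - 1 \<longleftrightarrow> [\<beta> ^ (m * k) = 1] (mod int p)"
    by (simp only: cong_iff_dvd_diff power_mult)
  also have "\<dots> \<longleftrightarrow> [int b ^ (m * k) = 1] (mod int p)"
    by (simp add: b cong_def power_mod)
  also have "\<dots> \<longleftrightarrow> [b ^ (m * k) = 1] (mod p)"
    using cong_int_iff[of "b ^ (m * k)" 1 p] by simp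
  also have "\<dots> \<longleftrightarrow> p - 1 dvd m * k"
    using ord ord_divides[of b "m * k" p] by (simp add: ord_mod_def b_def)
  also have "\<dots> \<longleftrightarrow> s dvd k" using \<open>m > 0\<close> unfolding m by (simp add: mult.commute[of s m])
  finally show ?thesis .
qed

theorem mainTheorem3:
  fixes p s r1 r2 :: nat
    and \<zeta> :: complex
    and K L :: "complex set"
    and u \<beta> \<alpha> :: int
    and \<sigma>\<^sub>u \<theta> :: "complex \<Rightarrow> complex"
    and t :: complex
    and \<tau> :: "nat \<Rightarrow> complex \<Rightarrow> complex"
    and \<Lambda> :: "real vec set"
  assumes "prime p"
    and "odd s" and "s dvd p - 1"
    and "primitive_unity_root p \<zeta>"
    and L_def: "L = adjoin_Rats \<zeta>"
    and "subfield K CC" and "K \<subseteq> L" and "ring.dimension CC s \<rat> K"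
    and "generates_units_mod p u"
    and "\<sigma>\<^sub>u \<in> ring_iso (as_ring L) (as_ring L)" and "\<sigma>\<^sub>u \<zeta> = \<zeta> powi u"
    and \<theta>_def: "\<theta> = restrict \<sigma>\<^sub>u K"
    and t_def: "t = rel_trace L K \<zeta>"
    and "ord_mod p \<beta> = p - 1"
    and \<alpha>_def: "\<alpha> = \<beta> ^ ((p - 1) div s)"
    and "embedding_enum K r1 r2 \<tau>"
    and \<Lambda>_def: "\<Lambda> = canonical_embedding r1 r2 \<tau> ` module_M_even p s K \<theta> t \<alpha>"
  shows "full_rank_lattice s \<Lambda> \<and> center_density s \<Lambda> \<ge> 1 / 2 powr ((real s + 2) / 2)"
proof -
  interpret F: cyclotomic_field p \<zeta> u L \<sigma>\<^sub>u
    by unfold_locales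
      (fact assms | erule generates_units_modD(2)[OF \<open>prime p\<close> \<open>generates_units_mod p u\<close>]
        | rule generates_units_modD(1)[OF \<open>prime p\<close> \<open>generates_units_mod p u\<close>])+
  interpret K: complex_subfield K
    by (rule complex_subfield.intro) fact
  have stabilizer: "(\<forall>x\<in>K. (\<sigma>\<^sub>u ^^ k) x = x) \<longleftrightarrow> s dvd k" for k
  proof -
    \<comment> \<open>The locale is first entered with this unknown \<open>n\<close>; uniqueness of
      the dimension then gives n = s.\<close>
    obtain n where n: "n dvd p - 1" "\<And>k. (\<forall>x\<in>K. (\<sigma>\<^sub>u ^^ k) x = x) \<longleftrightarrow> n dvd k"
      using F.exists_stabilizer[OF \<open>K \<subseteq> L\<close>] by blast
    interpret G: galois_subfield p \<zeta> u L \<sigma>\<^sub>u n K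
      by unfold_locales (fact assms n)+
    have "n = s"
      using ring.dimension_is_inj[OF CC_ring subfield_Rats G.dimension_K] assms by blast
    then show ?thesis using n by blast
  qed
  interpret G: galois_subfield p \<zeta> u L \<sigma>\<^sub>u s K
    by unfold_locales (fact assms stabilizer)+
  interpret C: root_of_unity_mod p s \<alpha>
    unfolding \<alpha>_def
    by unfold_locales (fact assms | rule power_primitive_root_order[OF \<open>prime p\<close> \<open>s dvd p - 1\<close> \<open>ord_mod p \<beta> = p - 1\<close>])+
  have \<theta>_t: "(\<theta> ^^ i) t = G.t i" for i
    unfolding \<theta>_def t_def G.rel_trace_zeta by (rule G.restrict_\<sigma>_pow_t)
  have r: "r1 = s" "r2 = 0" and bij: "bij_betw \<tau> {..<s} (embeddings K)"
    using G.embedding_enum_K[OF \<open>odd s\<close> \<open>embedding_enum K r1 r2 \<tau>\<close>] by auto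
  define x where "x a = (\<Sum>i<s. of_int (a $ i) * G.t i)" for a :: "int vec"
  have coords: "has_coords s \<theta> t y a \<longleftrightarrow> a \<in> carrier_vec s \<and> y = x a" for y a
    by (simp add: has_coords_def \<theta>_t x_def)
  have x_inj: "a = b" if "x a = x b" "a \<in> carrier_vec s" "b \<in> carrier_vec s" for a b
  proof (rule eq_vecI)
    fix i assume "i < dim_vec b"
    then have i: "i < s" using that by simp
    have "(\<Sum>i<s. of_int (a $ i - b $ i) * G.t i) = 0"
      using that(1) by (simp add: x_def left_diff_distrib sum_subtractf)
    then have "of_int (a $ i - b $ i) = (0::complex)"
      using G.periods_independent[of "\<lambda>i. of_int (a $ i - b $ i)" i] i by simp
    then show "a $ i = b $ i" by simp
  qed (use that in auto)
  have x_int: "x a \<in> ring_integers K" for a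
    using G.algebraic_int_period_combination[of "\<lambda>i. a $ i"]
    by (auto simp: ring_integers_def x_def intro!: K.sum K.mult K.of_int G.t_K)
  \<comment> \<open>The congruences and the parity condition each come with their own coordinate
    vector; injectivity of \<open>x\<close> merges the two.\<close>
  have module_eq: "module_M_even p s K \<theta> t \<alpha> = x ` {a. C.codeword a}"
    unfolding module_M_even_def module_M_def coords C.codeword_def
    using x_int x_inj by blast
  have \<Lambda>_eq: "\<Lambda> = {canonical_embedding r1 r2 \<tau> (x a) | a. C.codeword a}"
    unfolding \<Lambda>_def module_eq by blast
  define T where "T = mat s s (\<lambda>(j, i). Re (\<tau> j (G.t i)))"
  have T: "T \<in> carrier_mat s s" by (simp add: T_def)
  have hom: "complex_hom K (\<tau> j)" if "j < s" for j
    using bij that embeddings_iff[OF \<open>subfield K CC\<close>, of "\<tau> j"] by (auto dest: bij_betwE)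
  have "canonical_embedding r1 r2 \<tau> (x a) = T *\<^sub>v map_vec real_of_int a"
    if "a \<in> carrier_vec s" for a
  proof (rule eq_vecI)
    fix j assume "j < dim_vec (T *\<^sub>v map_vec real_of_int a)"
    then have j: "j < s" by (simp add: T_def)
    interpret h: complex_hom K "\<tau> j" by (rule hom[OF j])
    have "\<tau> j (x a) = (\<Sum>i<s. of_int (a $ i) * \<tau> j (G.t i))"
      by (simp add: x_def h.f_sum h.f_mult h.f_of_int K.mult K.of_int G.t_K)
    then have "Re (\<tau> j (x a)) = (\<Sum>i<s. Re (\<tau> j (G.t i)) * of_int (a $ i))"
      by (simp add: mult.commute)
    then show "canonical_embedding r1 r2 \<tau> (x a) $ j = (T *\<^sub>v map_vec real_of_int a) $ j"
      using j that by (simp add: canonical_embedding_def r T_def scalar_prod_def lessThan_atLeast0)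
  qed (simp add: canonical_embedding_def r T_def)
  then have \<Lambda>_T: "\<Lambda> = {T *\<^sub>v map_vec real_of_int a | a. C.codeword a}"
    unfolding \<Lambda>_eq by (metis (no_types, lifting) C.codeword_def)
  have "T\<^sup>T * T = mat s s (\<lambda>(i, j). (if i = j then real p else 0) - real ((p - 1) div s))"
  proof (rule eq_matI)
    fix i j
    assume "i < dim_row (mat s s (\<lambda>(i, j). (if i = j then real p else 0) - real ((p - 1) div s)))"
      and "j < dim_col (mat s s (\<lambda>(i, j). (if i = j then real p else 0) - real ((p - 1) div s)))"
    then have ij: "i < s" "j < s" by simp_all
    have "(T\<^sup>T * T) $$ (i, j) = (\<Sum>l<s. Re (\<tau> l (G.t i)) * Re (\<tau> l (G.t j)))"
      using ij by (simp add: T_def scalar_prod_def lessThan_atLeast0)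
    also have "\<dots> = (\<Sum>f\<in>embeddings K. Re (f (G.t i)) * Re (f (G.t j)))"
      by (rule sum.reindex_bij_betw[OF bij])
    also have "\<dots> = (\<Sum>k<s. Re (G.t (i + k)) * Re (G.t (j + k)))"
      unfolding G.embeddings_K
      by (subst sum.reindex[OF G.inj_on_embeddings_K]) (simp add: G.t_K G.\<sigma>_pow_t)
    \<comment> \<open>Since the periods are real, a conjugation may be inserted to reach the form of
      \<open>t_orthogonal\<close>.\<close>
    also have "\<dots> = Re (\<Sum>k<s. G.t (i + k) * cnj (G.t (j + k)))"
    proof -
      have "Im (G.t k) = 0" for k
        using G.cnj_t[OF \<open>odd s\<close>, of k] by (simp add: complex_eq_iff)
      then show ?thesis by simp
    qed
    also have "\<dots> = (if i = j then real p else 0) - real ((p - 1) div s)"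
      using ij unfolding G.t_orthogonal by (simp add: cong_def G.m_def)
    finally show "(T\<^sup>T * T) $$ (i, j)
        = mat s s (\<lambda>(i, j). (if i = j then real p else 0) - real ((p - 1) div s)) $$ (i, j)"
      using ij by simp
  qed (simp_all add: T_def)
  then show ?thesis using C.codeword_lattice_density[OF T _ \<Lambda>_T] by blast
qed

end
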